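(* Assume that either $K>0$ on $\mathbb{T}^d\times\mathbb{T}^d$ or $\lambda>0$. Then, for every probability measure $\nu$ on $\mathbb{T}^p\times\mathbb{T}^d$, the functional $\mathcal{J}_\nu$ admits a unique minimizer in $H$.
   Context: $\mathbb{T}=\mathbb{R}/\mathbb{Z}$, $D=p+d$ with integers $p,d\ge 1$, and $V\in\mathcal{C}^\infty(\mathbb{T}^D)$ where $\mathbb{T}^D=\mathbb{T}^p\times\mathbb{T}^d$; points are written $(q,y)$ or $(q,z)$ with $q\in\mathbb{T}^p$ and $y,z\in\mathbb{T}^d$, and $\nabla_y V(q,y)\in\mathbb{R}^d$ is the gradient of $V$ in its last $d$ variables. $\lambda\ge 0$, and $K\in\mathcal{C}^\infty(\mathbb{T}^d\times\mathbb{T}^d,\mathbb{R}_+)$ satisfies $\int_{\mathbb{T}^d}K(y,z)\,dz=1$ and $K(y,z)=K(z,y)$ for all $y,z\in\mathbb{T}^d$. $H=\{f\in H^1(\mathbb{T}^d):\int_{\mathbb{T}^d}f(z)\,dz=0\}$, where $H^1(\mathbb{T}^d)$ is the set of functions of $L^2(\mathbb{T}^d)$ with weak gradient in $L^2(\mathbb{T}^d)$. For a probability measure $\nu$ on $\mathbb{T}^p\times\mathbb{T}^d$ and $f\in H$, $$\mathcal{J}_\nu(f)=\int_{\mathbb{T}^p\times\mathbb{T}^d\times\mathbb{T}^d}|\nabla_yV(q,y)-\nabla f(z)|^2K(y,z)\,dz\,d\nu(q,y)+\lambda\int_{\mathbb{T}^d}|\nabla f(z)|^2\,dz.$$ *)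

theory Defs
  imports "HOL-Probability.Probability"
begin

quotient_type circle = real / "\<lambda>x y. x - y \<in> \<int>"
  morphisms rep_circle abs_circle
proof (rule equivpI)
  show "reflp (\<lambda>x y::real. x - y \<in> \<int>)"
    by (simp add: reflp_def)
  show "symp (\<lambda>x y::real. x - y \<in> \<int>)"
    unfolding symp_def by (metis Ints_minus minus_diff_eq)
  show "transp (\<lambda>x y::real. x - y \<in> \<int>)"
    unfolding transp_def by (metis Ints_add diff_add_cancel add_diff_eq)
qed

instantiation circle :: topological_space
begin

definition open_circle :: "circle set \<Rightarrow> bool"
  where "open_circle U \<longleftrightarrow> open (abs_circle -` U)"

instance
  by standard (auto simp: open_circle_def vimage_Union intro: open_Int open_UN)

end

type_synonym 'n torus = "circle ^ 'n"

definition torus_proj :: "real ^ 'n::finite \<Rightarrow> 'n torus"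
  where "torus_proj x = (\<chi> i. abs_circle (x $ i))"

lemma continuous_torus_proj: "continuous_on UNIV torus_proj"
proof -
  have c: "continuous_on UNIV abs_circle"
    by (auto simp: continuous_on_open_vimage open_circle_def)
  have "continuous_on UNIV (\<lambda>x::real ^ 'n. abs_circle (x $ i))" for i
    by (rule continuous_on_compose2[OF c]) (auto intro: continuous_intros)
  then show ?thesis
    unfolding torus_proj_def[abs_def] by (intro continuous_on_vec_lambda)
qed

text \<open>The normalised Lebesgue measure \<open>dz\<close> on the torus, on its Borel sets.\<close>

definition torus_measure :: "'n::finite torus measure"
  where "torus_measure = distr (restrict_space lborel (cbox 0 1)) borel torus_proj"

lemma prob_space_torus_measure: "prob_space (torus_measure :: 'n::finite torus measure)"
proof -
  have "emeasure lborel (cbox 0 (1 :: real ^ 'n)) = 1"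
    by (simp add: emeasure_lborel_cbox_eq Basis_vec_def inner_axis prod.neutral)
  then have "prob_space (restrict_space lborel (cbox 0 (1 :: real ^ 'n)))"
    by (intro prob_spaceI) (simp add: emeasure_restrict_space space_restrict_space)
  moreover have "torus_proj \<in> restrict_space lborel (cbox 0 (1 :: real ^ 'n)) \<rightarrow>\<^sub>M borel"
    using borel_measurable_continuous_onI[OF continuous_torus_proj]
    by (intro measurable_restrict_space1) simp
  ultimately show ?thesis
    unfolding torus_measure_def by (rule prob_space.prob_space_distr)
qed

text \<open>\<open>C\<^sup>k\<close> and \<open>C\<^sup>\<infinity>\<close> functions on a whole normed space. A function on a (product of) tori is
  smooth when its lift to the covering space, a periodic function, is.\<close>

primrec k_smooth ::
  "nat \<Rightarrow> ('a::real_normed_vector \<Rightarrow> 'b::real_normed_vector) \<Rightarrow> bool"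
where
  "k_smooth 0 f \<longleftrightarrow> continuous_on UNIV f"
| "k_smooth (Suc k) f \<longleftrightarrow>
     (\<forall>x. f differentiable (at x)) \<and> (\<forall>v. k_smooth k (\<lambda>x. frechet_derivative f (at x) v))"

definition smooth :: "('a::real_normed_vector \<Rightarrow> 'b::real_normed_vector) \<Rightarrow> bool"
  where "smooth f \<longleftrightarrow> (\<forall>k. k_smooth k f)"

text \<open>Lifts are periodic, so their gradient does not depend on the representative \<open>r\<close>.\<close>

definition torus_gradient :: "('n::finite torus \<Rightarrow> real) \<Rightarrow> 'n torus \<Rightarrow> real ^ 'n"
  where "torus_gradient \<phi> x =
    (THE D. \<forall>r. torus_proj r = x \<longrightarrow> GDERIV (\<phi> \<circ> torus_proj) r :> D)"

lemma torus_gradient_eq: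
  assumes "GDERIV (\<phi> \<circ> torus_proj) r :> D"
  shows "torus_gradient \<phi> (torus_proj r) = D"
proof -
  have *: "GDERIV (\<phi> \<circ> torus_proj) s :> D" if "torus_proj s = torus_proj r" for s
  proof -
    have "s $ i - r $ i \<in> \<int>" for i
      using that by (simp add: torus_proj_def vec_eq_iff circle.abs_eq_iff)
    then have "torus_proj (x + (r - s)) = torus_proj x" for x
      unfolding torus_proj_def vec_eq_iff
      by (simp add: circle.abs_eq_iff) (metis Ints_minus minus_diff_eq)
    then have eq: "(\<lambda>x. (\<phi> \<circ> torus_proj) (x + (r - s))) = \<phi> \<circ> torus_proj"
      by (auto simp: fun_eq_iff)
    have "((\<lambda>x. (\<phi> \<circ> torus_proj) (x + (r - s))) has_derivative (\<lambda>h. h \<bullet> D)) (at s)"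
    proof (rule has_derivative_compose[where f = "\<lambda>x. x + (r - s)" and f' = "\<lambda>h. h"])
      show "((\<lambda>x. x + (r - s)) has_derivative (\<lambda>h. h)) (at s)"
        by (auto intro!: derivative_eq_intros)
      show "((\<phi> \<circ> torus_proj) has_derivative (\<lambda>h. h \<bullet> D)) (at (s + (r - s)))"
        using assms by (simp add: gderiv_def)
    qed
    then show ?thesis
      unfolding eq gderiv_def .
  qed
  have "E = D" if "GDERIV (\<phi> \<circ> torus_proj) r :> E" for E
  proof -
    have "(\<lambda>h. h \<bullet> E) = (\<lambda>h. h \<bullet> D)"
      using that assms unfolding gderiv_def by (rule has_derivative_unique)
    then show ?thesis
      by (metis inner_commute vector_eq_rdot)
  qed
  with * show ?thesis
    unfolding torus_gradient_def by (intro the_equality) auto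
qed

definition square_integrable :: "'a measure \<Rightarrow> ('a \<Rightarrow> 'b::euclidean_space) \<Rightarrow> bool"
  where "square_integrable M f \<longleftrightarrow>
    f \<in> borel_measurable M \<and> integrable M (\<lambda>x. (norm (f x))\<^sup>2)"

definition has_weak_gradient ::
    "('n::finite torus \<Rightarrow> real) \<Rightarrow> ('n torus \<Rightarrow> real ^ 'n) \<Rightarrow> bool"
  where "has_weak_gradient f g \<longleftrightarrow>
    (\<forall>\<phi>. smooth (\<phi> \<circ> torus_proj) \<longrightarrow>
       (\<integral>x. f x *\<^sub>R torus_gradient \<phi> x \<partial>torus_measure) = - (\<integral>x. \<phi> x *\<^sub>R g x \<partial>torus_measure))"

text \<open>\<open>L\<^sup>2\<close> and Sobolev functions are represented by genuine functions; elements of the corresponding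
  spaces are classes modulo equality almost everywhere.\<close>

definition H1 :: "('n::finite torus \<Rightarrow> real) set"
  where "H1 = {f. square_integrable torus_measure f \<and>
    (\<exists>g. square_integrable torus_measure g \<and> has_weak_gradient f g)}"

definition H1_mean_zero :: "('n::finite torus \<Rightarrow> real) set"
  where "H1_mean_zero = {f \<in> H1. (\<integral>z. f z \<partial>torus_measure) = 0}"

text \<open>For \<open>f\<close> in \<open>H1\<close> the weak gradient exists and is unique up to a null set, on which the
  functional below does not depend.\<close>

definition weak_gradient :: "('n::finite torus \<Rightarrow> real) \<Rightarrow> 'n torus \<Rightarrow> real ^ 'n"
  where "weak_gradient f =
    (SOME g. square_integrable torus_measure g \<and> has_weak_gradient f g)"

definition J_functional ::
    "('p::finite torus \<times> 'd::finite torus \<Rightarrow> real) \<Rightarrow> ('d torus \<times> 'd torus \<Rightarrow> real) \<Rightarrow> real \<Rightarrow>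
     ('p torus \<times> 'd torus) measure \<Rightarrow> ('d torus \<Rightarrow> real) \<Rightarrow> real"
  where "J_functional V K lam \<nu> f =
    integral\<^sup>L (\<nu> \<Otimes>\<^sub>M torus_measure)
      (\<lambda>((q, y), z). (norm (torus_gradient (\<lambda>y'. V (q, y')) y - weak_gradient f z))\<^sup>2 * K (y, z))
    + lam * (\<integral>z. (norm (weak_gradient f z))\<^sup>2 \<partial>torus_measure)"

end

theory Submission imports Defs begin

text \<open>
  The functional depends on \<open>f\<close> only through its weak gradient \<open>g\<close>, and as a function of \<open>g\<close> it is
  quadratic. Write \<open>W(q, y)\<close> for the gradient of \<open>V\<close> in \<open>y\<close>, and let \<open>k0\<close> be the minimum of \<open>K\<close>,
  or \<open>0\<close> if \<open>\<lambda>\<close> is positive. The parallelogram identity, applied pointwise, gives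
  \<open>J((g + h) / 2) \<le> (J(g) + J(h)) / 2 - (k0 + \<lambda>) / 4 * \<parallel>g - h\<parallel>\<^sup>2\<close>, and \<open>k0 + \<lambda> > 0\<close> because a
  positive \<open>K\<close> attains a positive minimum on the compact torus (\<open>cost_midpoint\<close>). Hence the
  gradients of a minimizing sequence are Cauchy in \<open>L\<^sup>2\<close>, a limit of them is a minimizer because \<open>J\<close>
  is continuous for this distance (\<open>cost_perturbation\<close>, \<open>quadratic_minimizer_exists\<close>), and two
  minimizers have the same gradient almost everywhere.

  What remains is to see that \<open>f\<close> is controlled by \<open>g\<close>: a limit of gradients must again be a
  gradient, and a gradient must determine \<open>f\<close>. Both follow from the Poincare inequality on mean-zero
  functions (\<open>torus_Poincare\<close>). It comes from averaging Taylor's formula over displacements: for smooth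
  \<open>\<phi>\<close>, integrating \<open>\<phi>(x + h) - \<phi>(x) = \<integral>\<^sub>0\<^sup>1 h \<bullet> \<nabla>\<phi>(x + t h) dt\<close> over \<open>h\<close> in the unit cube produces the mean
  of \<open>\<phi>\<close> minus \<open>\<phi>(x)\<close>. By duality every mean-zero \<open>f\<close> with weak gradient \<open>g\<close> satisfies
  \<open>f(x) = \<integral>\<integral> h \<bullet> g(x - t h) dt dh\<close> almost everywhere, and the Jensen inequality bounds the \<open>L\<^sup>2\<close> norm
  of \<open>f\<close> by that of \<open>g\<close>.

  The duality argument rests on two facts about the torus. Its measure is invariant under
  translations (\<open>distr_torus_shift\<close>). And an integrable function orthogonal to all smooth
  functions vanishes almost everywhere (\<open>AE_eq_0_if_orthogonal_to_smooth\<close>); this also makes weak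
  gradients unique. The second fact is a consequence of the Stone-Weierstrass theorem for the embedding of the
  torus into a product of complex unit circles, where polynomials restrict to trigonometric
  polynomials.
\<close>

section \<open>The torus as a quotient of Euclidean space\<close>

text \<open>Normalising \<open>rep_circle\<close>, an unspecified choice of representatives, to \<open>[0, 1)\<close> makes the
  section Borel measurable and bounded.\<close>

definition circle_rep :: "circle \<Rightarrow> real"
  where "circle_rep x = frac (rep_circle x)"

definition torus_rep :: "'n::finite torus \<Rightarrow> real ^ 'n"
  where "torus_rep x = (\<chi> i. circle_rep (x $ i))"

lemma abs_circle_rep: "abs_circle (circle_rep x) = x"
proof -
  have "abs_circle (frac (rep_circle x)) = abs_circle (rep_circle x)"
    by (simp add: circle.abs_eq_iff frac_def)
  then show ?thesis
    unfolding circle_rep_def using Quotient_abs_rep[OF Quotient_circle] by metis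
qed

lemma circle_rep_abs: "circle_rep (abs_circle r) = frac r"
proof -
  have "abs_circle (circle_rep (abs_circle r)) = abs_circle r"
    by (rule abs_circle_rep)
  then have "circle_rep (abs_circle r) - r \<in> \<int>"
    by (simp add: circle.abs_eq_iff)
  then obtain k where "circle_rep (abs_circle r) = r + of_int k"
    by (metis Ints_cases add.commute diff_add_cancel)
  then have "frac (circle_rep (abs_circle r)) = frac r"
    by (simp add: frac_def)
  then show ?thesis
    by (simp add: circle_rep_def)
qed

lemma circle_rep_range: "0 \<le> circle_rep x" "circle_rep x < 1"
  by (simp_all add: circle_rep_def frac_lt_1)

lemma open_abs_circle_image:
  assumes "open U"
  shows "open (abs_circle ` U)"
proof -
  have "abs_circle -` (abs_circle ` U) = (\<Union>k::int. (\<lambda>x. x + of_int k) ` U)"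
  proof (intro set_eqI iffI)
    fix x assume "x \<in> abs_circle -` (abs_circle ` U)"
    then obtain u where "abs_circle x = abs_circle u" "u \<in> U" by auto
    then obtain k where "x - u = of_int k"
      by (auto simp: circle.abs_eq_iff elim: Ints_cases)
    then have "x = u + of_int k" by simp
    with \<open>u \<in> U\<close> show "x \<in> (\<Union>k::int. (\<lambda>x. x + of_int k) ` U)" by auto
  next
    fix x assume "x \<in> (\<Union>k::int. (\<lambda>x. x + of_int k) ` U)"
    then obtain k :: int and u where "u \<in> U" "x = u + of_int k" by auto
    then show "x \<in> abs_circle -` (abs_circle ` U)"
      by (auto intro!: image_eqI[of _ _ u] simp: circle.abs_eq_iff)
  qed
  moreover have "open ((\<lambda>x. x + of_int k) ` U)" for k
    using open_translation[OF assms, of "of_int k"] by (simp add: add.commute)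
  ultimately show ?thesis
    by (simp add: open_circle_def open_UN)
qed

text \<open>The section is continuous off the base point: the projection maps open subintervals of \<open>(0, 1)\<close> to
  open arcs, and the base point itself is the complement of an open arc.\<close>

lemma borel_measurable_circle_rep: "circle_rep \<in> borel_measurable borel"
proof -
  have img: "{x. P (circle_rep x)} = abs_circle ` {r \<in> {0..<1}. P r}" for P
  proof safe
    fix x assume "P (circle_rep x)"
    then show "x \<in> abs_circle ` {r \<in> {0..<1}. P r}"
      by (intro image_eqI[of _ _ "circle_rep x"]) (auto simp: abs_circle_rep circle_rep_range)
  next
    fix r :: real assume "r \<in> {0..<1}" "P r"
    then show "P (circle_rep (abs_circle r))"
      by (simp add: circle_rep_abs frac_eq)
  qed
  have pos: "{x. 0 < circle_rep x \<and> circle_rep x < a} \<in> sets borel" if "a \<le> 1" for a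
  proof -
    have "{x. 0 < circle_rep x \<and> circle_rep x < a} = abs_circle ` {0<..<a}"
      using that by (subst img) (rule arg_cong[where f = "image abs_circle"], auto)
    then show ?thesis
      by (auto intro!: borel_open open_abs_circle_image)
  qed
  have zero: "{x. circle_rep x = 0} \<in> sets borel"
  proof -
    have "{x. circle_rep x = 0} = UNIV - {x. 0 < circle_rep x \<and> circle_rep x < 1}"
      using circle_rep_range by (auto simp: order_less_le)
    then show ?thesis
      using pos[of 1] by auto
  qed
  have "{x. circle_rep x < a} \<in> sets borel" for a
  proof (cases "0 < a")
    case True
    have "{x. circle_rep x < a}
        = {x. circle_rep x = 0} \<union> {x. 0 < circle_rep x \<and> circle_rep x < min a 1}"
      using True circle_rep_range by (auto simp: order_less_le)
    then show ?thesis
      using zero pos[of "min a 1"] by auto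
  next
    case False
    then have "{x. circle_rep x < a} = {}"
      using circle_rep_range(1) by (auto simp: not_less intro: order_trans)
    then show ?thesis by simp
  qed
  then show ?thesis
    by (intro borel_measurable_iff_less[THEN iffD2]) auto
qed

lemma borel_measurable_vec_lambda:
  fixes f :: "'i::finite \<Rightarrow> 'a \<Rightarrow> real"
  assumes "\<And>i. f i \<in> borel_measurable M"
  shows "(\<lambda>x. \<chi> i. f i x) \<in> borel_measurable M"
  by (rule borel_measurable_euclidean_space[THEN iffD2])
     (use assms in \<open>auto simp: Basis_vec_def inner_axis\<close>)

lemma borel_measurable_torus_rep [measurable]:
  "torus_rep \<in> borel_measurable borel"
  unfolding torus_rep_def
  by (intro borel_measurable_vec_lambda measurable_compose[OF _ borel_measurable_circle_rep]
      borel_measurable_continuous_onI continuous_intros)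

lemma measurable_torus_proj [measurable]: "torus_proj \<in> borel \<rightarrow>\<^sub>M borel"
  by (rule borel_measurable_continuous_onI[OF continuous_torus_proj])

lemma torus_proj_rep [simp]: "torus_proj (torus_rep x) = x"
  by (simp add: torus_proj_def torus_rep_def vec_eq_iff abs_circle_rep)

lemma torus_rep_in_cbox: "torus_rep x \<in> cbox 0 1"
  by (simp add: torus_rep_def mem_box_cart circle_rep_range less_imp_le)

lemma torus_proj_eq_iff: "torus_proj a = torus_proj b \<longleftrightarrow> (\<forall>i. a $ i - b $ i \<in> \<int>)"
  by (simp add: torus_proj_def vec_eq_iff circle.abs_eq_iff)

lemma torus_proj_add_cong:
  assumes "torus_proj a = torus_proj b"
  shows "torus_proj (a + h) = torus_proj (b + h)"
  using assms by (simp add: torus_proj_eq_iff)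

lemma space_torus_measure [simp]: "space torus_measure = UNIV"
  and sets_torus_measure [simp, measurable_cong]: "sets torus_measure = sets borel"
  by (simp_all add: torus_measure_def)

text \<open>Composing the periodic lift of a function with the Borel section recovers the function, so Borel
  measurability can be checked on Euclidean space.\<close>

lemma borel_measurable_lift:
  fixes \<phi> :: "'n::finite torus \<Rightarrow> 'b::topological_space"
  assumes "continuous_on UNIV (\<phi> \<circ> torus_proj)"
  shows "\<phi> \<in> borel \<rightarrow>\<^sub>M borel"
proof -
  have "(\<phi> \<circ> torus_proj) \<circ> torus_rep \<in> borel \<rightarrow>\<^sub>M borel"
    using borel_measurable_continuous_onI[OF assms] by (rule measurable_comp[rotated]) simp
  then show ?thesis
    by (simp add: comp_def)
qed

lemma bounded_lift:
  fixes \<phi> :: "'n::finite torus \<Rightarrow> 'b::real_normed_vector"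
  assumes "continuous_on UNIV (\<phi> \<circ> torus_proj)"
  obtains B where "\<And>x. norm (\<phi> x) \<le> B"
proof -
  have "compact ((\<phi> \<circ> torus_proj) ` cbox 0 1)"
    by (intro compact_continuous_image compact_cbox continuous_on_subset[OF assms subset_UNIV])
  then obtain B where "\<forall>x\<in>(\<phi> \<circ> torus_proj) ` cbox 0 1. norm x \<le> B"
    using compact_imp_bounded bounded_iff by metis
  then have "norm (\<phi> x) \<le> B" for x
    using torus_rep_in_cbox[of x] by (auto dest: bspec[where x = "torus_rep x"])
  then show ?thesis by (rule that)
qed

text \<open>The measure on a product of tori lives on the Borel sets of the product topology. Going through the
  Euclidean section, where Borel sets of a product are generated by rectangles, avoids comparing
  this \<open>\<sigma>\<close>-algebra with the product \<open>\<sigma>\<close>-algebra.\<close>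

lemma borel_measurable_lift2:
  fixes \<phi> :: "'m::finite torus \<times> 'n::finite torus \<Rightarrow> 'b::topological_space"
  assumes "continuous_on UNIV (\<phi> \<circ> map_prod torus_proj torus_proj)"
    and [measurable]: "f \<in> M \<rightarrow>\<^sub>M borel" "g \<in> M \<rightarrow>\<^sub>M borel"
  shows "(\<lambda>\<omega>. \<phi> (f \<omega>, g \<omega>)) \<in> M \<rightarrow>\<^sub>M borel"
proof -
  have "(\<lambda>\<omega>. (torus_rep (f \<omega>), torus_rep (g \<omega>))) \<in> M \<rightarrow>\<^sub>M borel"
    by measurable
  then have "(\<phi> \<circ> map_prod torus_proj torus_proj) \<circ> (\<lambda>\<omega>. (torus_rep (f \<omega>), torus_rep (g \<omega>)))
      \<in> M \<rightarrow>\<^sub>M borel"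
    using borel_measurable_continuous_onI[OF assms(1)] by (rule measurable_comp)
  then show ?thesis
    by (simp add: comp_def)
qed

lemma lift2_values:
  fixes \<phi> :: "'m::finite torus \<times> 'n::finite torus \<Rightarrow> 'b::real_normed_vector"
  shows "range \<phi> = (\<phi> \<circ> map_prod torus_proj torus_proj) ` (cbox 0 1 \<times> cbox 0 1)"
proof -
  have "\<phi> p \<in> (\<phi> \<circ> map_prod torus_proj torus_proj) ` (cbox 0 1 \<times> cbox 0 1)" for p
    by (rule image_eqI[of _ _ "(torus_rep (fst p), torus_rep (snd p))"])
      (auto simp: torus_rep_in_cbox)
  then show ?thesis by auto
qed

lemma compact_range_lift2:
  fixes \<phi> :: "'m::finite torus \<times> 'n::finite torus \<Rightarrow> 'b::real_normed_vector"
  assumes "continuous_on UNIV (\<phi> \<circ> map_prod torus_proj torus_proj)"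
  shows "compact (range \<phi>)"
  unfolding lift2_values
  by (intro compact_continuous_image compact_Times compact_cbox
      continuous_on_subset[OF assms subset_UNIV])

section \<open>Smooth functions and their gradients\<close>

text \<open>A derivative known in closed form replaces the Frechet derivative chosen in the definition.\<close>

lemma k_smooth_SucI:
  assumes "\<And>x. (f has_derivative f' x) (at x)" "\<And>v. k_smooth k (\<lambda>x. f' x v)"
  shows "k_smooth (Suc k) f"
proof -
  have "frechet_derivative f (at x) = f' x" for x
    using frechet_derivative_at[OF assms(1)] by simp
  then show ?thesis
    using assms by (auto simp: differentiable_def)
qed

lemma k_smooth_Suc_has_derivative:
  assumes "k_smooth (Suc k) f"
  shows "(f has_derivative frechet_derivative f (at x)) (at x)"
  using assms by (simp add: frechet_derivative_works)

lemma k_smooth_SucD: "k_smooth (Suc k) f \<Longrightarrow> k_smooth k f"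
proof (induction k arbitrary: f)
  case 0
  then show ?case
    by (auto intro!: continuous_at_imp_continuous_on differentiable_imp_continuous_within)
qed auto

lemma k_smooth_const: "k_smooth k (\<lambda>x. c)"
  by (induction k arbitrary: c) auto

lemma k_smooth_add:
  "k_smooth k f \<Longrightarrow> k_smooth k g \<Longrightarrow> k_smooth k (\<lambda>x. f x + g x)"
proof (induction k arbitrary: f g)
  case (Suc k)
  show ?case
    by (rule k_smooth_SucI[OF has_derivative_add[OF k_smooth_Suc_has_derivative[OF Suc.prems(1)]
            k_smooth_Suc_has_derivative[OF Suc.prems(2)]]])
       (use Suc in simp)
qed (simp add: continuous_on_add)

lemma k_smooth_mult:
  fixes f g :: "'a::real_normed_vector \<Rightarrow> real"
  shows "k_smooth k f \<Longrightarrow> k_smooth k g \<Longrightarrow> k_smooth k (\<lambda>x. f x * g x)"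
proof (induction k arbitrary: f g)
  case (Suc k)
  have "k_smooth k f" "k_smooth k g"
    using Suc.prems k_smooth_SucD by blast+
  then show ?case
    by (intro k_smooth_SucI[OF has_derivative_mult[OF k_smooth_Suc_has_derivative[OF Suc.prems(1)]
            k_smooth_Suc_has_derivative[OF Suc.prems(2)]]] k_smooth_add Suc.IH)
       (use Suc.prems in simp_all)
qed (simp add: continuous_on_mult)

lemma k_smooth_shift:
  "k_smooth k f \<Longrightarrow> k_smooth k (\<lambda>x. f (x + a))"
proof (induction k arbitrary: f)
  case 0
  have "continuous_on UNIV (\<lambda>x. x + a)"
    by (intro continuous_intros)
  with 0 show ?case
    using continuous_on_compose2[of UNIV f UNIV "\<lambda>x. x + a"] by simp
next
  case (Suc k)
  have "((\<lambda>x. f (x + a)) has_derivative frechet_derivative f (at (x + a))) (at x)" for x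
    by (rule has_derivative_compose[where f = "\<lambda>x. x + a" and f' = "\<lambda>h. h"])
      (auto intro!: derivative_eq_intros k_smooth_Suc_has_derivative[OF Suc.prems])
  then show ?case
    by (rule k_smooth_SucI) (use Suc in auto)
qed

text \<open>The phase \<open>b\<close> makes the class of sines closed under differentiation, up to
  constant factors.\<close>

lemma k_smooth_sin_coordinate:
  "k_smooth k (\<lambda>x::real ^ 'n::finite. sin (c * x $ i + b))"
proof (induction k arbitrary: b)
  case (Suc k)
  have "((\<lambda>x::real ^ 'n. sin (c * x $ i + b)) has_derivative
      (\<lambda>v. (c * v $ i) * sin (c * x $ i + (b + pi / 2)))) (at x)" for x
  proof -
    have "((\<lambda>x::real ^ 'n. x $ i) has_derivative (\<lambda>v. v $ i)) (at x)"
      by (rule bounded_linear.has_derivative[OF bounded_linear_vec_nth]) simp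
    then have "((\<lambda>x::real ^ 'n. sin (c * x $ i + b)) has_derivative
        (\<lambda>v. (c * v $ i) * cos (c * x $ i + b))) (at x)"
      by (auto intro!: derivative_eq_intros simp: ac_simps)
    moreover have "cos (c * x $ i + b) = sin (c * x $ i + (b + pi / 2))"
      using sin_add[of "c * x $ i + b" "pi / 2"] by (simp add: add.assoc)
    ultimately show ?thesis by simp
  qed
  then show ?case
    by (rule k_smooth_SucI) (intro k_smooth_mult k_smooth_const Suc.IH)
qed (simp, intro continuous_intros)

lemma smooth_const: "smooth (\<lambda>x. c)"
  and smooth_add: "smooth f \<Longrightarrow> smooth g \<Longrightarrow> smooth (\<lambda>x. f x + g x)"
  and smooth_shift: "smooth f \<Longrightarrow> smooth (\<lambda>x. f (x + a))"
  by (simp_all add: smooth_def k_smooth_const k_smooth_add k_smooth_shift)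

lemma smooth_mult:
  fixes f g :: "'a::real_normed_vector \<Rightarrow> real"
  shows "smooth f \<Longrightarrow> smooth g \<Longrightarrow> smooth (\<lambda>x. f x * g x)"
  by (simp add: smooth_def k_smooth_mult)

lemma smooth_sum: "(\<And>i. i \<in> I \<Longrightarrow> smooth (f i)) \<Longrightarrow> smooth (\<lambda>x. \<Sum>i\<in>I. f i x)"
  by (induction I rule: infinite_finite_induct) (auto intro: smooth_const smooth_add)

lemma smooth_imp_continuous: "smooth f \<Longrightarrow> continuous_on UNIV f"
  unfolding smooth_def by (drule spec[of _ 0]) simp

lemma smooth_has_derivative:
  "smooth f \<Longrightarrow> (f has_derivative frechet_derivative f (at x)) (at x)"
  using k_smooth_Suc_has_derivative unfolding smooth_def by blast

lemma smooth_continuous_derivative: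
  "smooth f \<Longrightarrow> continuous_on UNIV (\<lambda>x. frechet_derivative f (at x) v)"
  unfolding smooth_def by (drule spec[of _ "Suc 0"]) simp

lemma has_derivative_imp_GDERIV:
  fixes f :: "real ^ 'n::finite \<Rightarrow> real"
  assumes "(f has_derivative f') (at r)"
  shows "GDERIV f r :> (\<chi> i. f' (axis i 1))"
proof -
  interpret f': bounded_linear f'
    using assms by (rule has_derivative_bounded_linear)
  have eq: "f' h = h \<bullet> (\<chi> i. f' (axis i 1))" for h
  proof -
    have "f' h = f' (\<Sum>i\<in>UNIV. (h $ i) *\<^sub>R axis i 1)"
      using basis_expansion[of h] by (simp add: scalar_mult_eq_scaleR)
    also have "\<dots> = (\<Sum>i\<in>UNIV. h $ i * f' (axis i 1))"
      by (simp add: f'.sum f'.scaleR)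
    finally show ?thesis
      by (simp add: inner_vec_def)
  qed
  show ?thesis
    unfolding gderiv_def by (rule has_derivative_eq_rhs[OF assms]) (rule ext, rule eq)
qed

lemma torus_gradient_smooth:
  fixes \<phi> :: "'n::finite torus \<Rightarrow> real"
  assumes "smooth (\<phi> \<circ> torus_proj)"
  shows "GDERIV (\<phi> \<circ> torus_proj) r :> torus_gradient \<phi> (torus_proj r)"
    and "continuous_on UNIV (torus_gradient \<phi> \<circ> torus_proj)"
proof -
  define D where "D r = (\<chi> i. frechet_derivative (\<phi> \<circ> torus_proj) (at r) (axis i 1))" for r
  have D: "GDERIV (\<phi> \<circ> torus_proj) r :> D r" for r
    unfolding D_def by (intro has_derivative_imp_GDERIV smooth_has_derivative assms)
  then have eq: "torus_gradient \<phi> (torus_proj r) = D r" for r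
    by (rule torus_gradient_eq)
  show "GDERIV (\<phi> \<circ> torus_proj) r :> torus_gradient \<phi> (torus_proj r)"
    using D eq by simp
  have "continuous_on UNIV D"
    unfolding D_def by (intro continuous_on_vec_lambda smooth_continuous_derivative assms)
  then show "continuous_on UNIV (torus_gradient \<phi> \<circ> torus_proj)"
    by (simp add: comp_def eq)
qed

text \<open>The gradient in the last variables is read off from the full Frechet derivative, whose continuity is
  joint in both variables.\<close>

lemma continuous_partial_torus_gradient:
  fixes V :: "'p::finite torus \<times> 'd::finite torus \<Rightarrow> real"
  assumes "smooth (V \<circ> map_prod torus_proj torus_proj)"
  shows "continuous_on UNIV
    ((\<lambda>(q, y). torus_gradient (\<lambda>y'. V (q, y')) y) \<circ> map_prod torus_proj torus_proj)"
proof -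
  let ?F = "V \<circ> map_prod torus_proj torus_proj"
  define D where "D p = (\<chi> i. frechet_derivative ?F (at p) (0, axis i 1))" for p
  have "torus_gradient (\<lambda>y'. V (torus_proj a, y')) (torus_proj b) = D (a, b)" for a b
  proof -
    have "((\<lambda>y. (a, y)) has_derivative (\<lambda>v. (0, v))) (at b)"
      by (auto intro!: derivative_eq_intros)
    then have "((\<lambda>y. ?F (a, y)) has_derivative (\<lambda>v. frechet_derivative ?F (at (a, b)) (0, v))) (at b)"
      using has_derivative_compose smooth_has_derivative[OF assms, of "(a, b)"] by blast
    then have "GDERIV ((\<lambda>y'. V (torus_proj a, y')) \<circ> torus_proj) b :> D (a, b)"
      unfolding D_def by (intro has_derivative_imp_GDERIV) (simp add: comp_def)
    then show ?thesis
      by (rule torus_gradient_eq)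
  qed
  then have eq: "(\<lambda>(q, y). torus_gradient (\<lambda>y'. V (q, y')) y) \<circ> map_prod torus_proj torus_proj = D"
    by (auto simp: fun_eq_iff)
  show ?thesis
    unfolding eq D_def by (intro continuous_on_vec_lambda smooth_continuous_derivative assms)
qed

section \<open>Integrable functions orthogonal to smooth functions\<close>

text \<open>The embedding into a product of unit circles brings the torus into Euclidean space, where
  polynomials approximate continuous functions and distances to closed sets are available.\<close>

definition torus_embed :: "'n::finite torus \<Rightarrow> complex ^ 'n"
  where "torus_embed x = (\<chi> i. cis (2 * pi * circle_rep (x $ i)))"

lemma cis_circle_rep: "cis (2 * pi * circle_rep (abs_circle r)) = cis (2 * pi * r)"
proof -
  have "cis (2 * pi * frac r) = cis (2 * pi * r) / cis (2 * pi * of_int \<lfloor>r\<rfloor>)"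
    by (simp only: frac_def right_diff_distrib cis_divide)
  then show ?thesis
    by (simp add: circle_rep_abs cis_multiple_2pi)
qed

lemma torus_embed_proj: "torus_embed (torus_proj r) = (\<chi> i. cis (2 * pi * r $ i))"
  by (simp add: torus_embed_def torus_proj_def cis_circle_rep)

lemma continuous_torus_embed: "continuous_on UNIV (torus_embed :: 'n::finite torus \<Rightarrow> _)"
proof -
  have "continuous_on UNIV (\<lambda>c. cis (2 * pi * circle_rep c))"
  proof (rule continuous_on_open_vimage[THEN iffD2, rule_format])
    fix B :: "complex set" assume "open B"
    have "continuous_on UNIV (\<lambda>r. cis (2 * pi * r))"
      by (intro continuous_intros)
    then have "open ((\<lambda>r. cis (2 * pi * r)) -` B)"
      using \<open>open B\<close> by (auto simp: continuous_on_open_vimage)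
    then show "open ((\<lambda>c. cis (2 * pi * circle_rep c)) -` B \<inter> UNIV)"
      by (simp add: open_circle_def vimage_def cis_circle_rep)
  qed simp
  then have "continuous_on UNIV (\<lambda>x::'n torus. cis (2 * pi * circle_rep (x $ i)))" for i
    by (rule continuous_on_compose2) (auto intro: continuous_intros)
  then show ?thesis
    unfolding torus_embed_def by (intro continuous_on_vec_lambda)
qed

lemma inj_torus_embed: "inj torus_embed"
proof (rule injI)
  fix x y :: "'n::finite torus" assume eq: "torus_embed x = torus_embed y"
  have "x $ i = y $ i" for i
  proof -
    have "cis (2 * pi * circle_rep (x $ i)) = cis (2 * pi * circle_rep (y $ i))"
      using eq by (simp add: torus_embed_def vec_eq_iff)
    then have "sin (2 * pi * circle_rep (x $ i)) = sin (2 * pi * circle_rep (y $ i)) \<and>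
        cos (2 * pi * circle_rep (x $ i)) = cos (2 * pi * circle_rep (y $ i))"
      by (simp add: complex_eq_iff)
    then obtain n :: int where
      "2 * pi * circle_rep (x $ i) = 2 * pi * circle_rep (y $ i) + 2 * pi * of_int n"
      by (auto simp: sin_cos_eq_iff)
    then have "2 * pi * (circle_rep (x $ i) - circle_rep (y $ i)) = 2 * pi * of_int n"
      by (simp add: algebra_simps)
    then have "circle_rep (x $ i) - circle_rep (y $ i) = of_int n"
      by simp
    then have "abs_circle (circle_rep (x $ i)) = abs_circle (circle_rep (y $ i))"
      by (simp add: circle.abs_eq_iff)
    then show ?thesis
      by (simp add: abs_circle_rep)
  qed
  then show "x = y"
    by (simp add: vec_eq_iff)
qed

lemma compact_torus: "compact (UNIV :: 'n::finite torus set)"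
proof -
  have "torus_proj ` cbox 0 (1 :: real ^ 'n) = (UNIV :: 'n torus set)"
    using torus_rep_in_cbox torus_proj_rep by (metis UNIV_eq_I image_eqI)
  then show ?thesis
    by (metis compact_continuous_image compact_cbox continuous_on_subset continuous_torus_proj
        subset_UNIV)
qed

lemma compact_torus_embed_image:
  assumes "closed C"
  shows "compact (torus_embed ` C)"
proof -
  have "compact C"
    using compact_Int_closed[OF compact_torus assms] by simp
  then show ?thesis
    by (rule compact_continuous_image[rotated])
       (rule continuous_on_subset[OF continuous_torus_embed subset_UNIV])
qed

text \<open>Coordinates of the embedding are sines and cosines, and smooth functions form a ring.\<close>

lemma smooth_polynomial_torus_embed:
  fixes g :: "complex ^ 'n::finite \<Rightarrow> real"
  assumes "real_polynomial_function g"
  shows "smooth ((\<lambda>x. g (torus_embed x)) \<circ> torus_proj)"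
  using assms
proof induction
  case (linear f)
  have sm: "smooth (\<lambda>r. torus_embed (torus_proj r) \<bullet> b)" if b: "b \<in> Basis" for b :: "complex ^ 'n"
  proof -
    obtain i u where b: "b = axis i u" and u: "u \<in> {1, \<i>}"
      using b by (auto simp: Basis_vec_def Basis_complex_def)
    have "cos t = sin (t + pi / 2)" for t :: real
      by (simp add: sin_add)
    then have "smooth (\<lambda>r::real ^ 'n. cos (2 * pi * r $ i))"
      using k_smooth_sin_coordinate[of _ "2 * pi" i "pi / 2"] by (simp add: smooth_def)
    moreover have "smooth (\<lambda>r::real ^ 'n. sin (2 * pi * r $ i))"
      using k_smooth_sin_coordinate[of _ "2 * pi" i 0] by (simp add: smooth_def)
    ultimately show ?thesis
      using u by (auto simp: b inner_axis torus_embed_proj inner_complex_def)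
  qed
  interpret f: bounded_linear f by fact
  have eq: "f w = (\<Sum>b\<in>Basis. (w \<bullet> b) * f b)" for w
    by (subst (1) euclidean_representation[of w, symmetric]) (simp only: f.sum f.scaleR real_scaleR_def)
  have "(\<lambda>x. f (torus_embed x)) \<circ> torus_proj
      = (\<lambda>r. \<Sum>b\<in>Basis. (torus_embed (torus_proj r) \<bullet> b) * f b)"
    unfolding comp_def by (rule ext) (rule eq)
  then show ?case
    by (simp add: smooth_sum smooth_mult smooth_const sm)
qed (auto simp: comp_def intro: smooth_const smooth_add smooth_mult)

lemma integrable_smooth_mult:
  assumes "continuous_on UNIV (\<phi> \<circ> torus_proj)" "integrable torus_measure u"
  shows "integrable torus_measure (\<lambda>x. (\<phi> x :: real) * u x)"
proof -
  obtain B where B: "\<And>x. norm (\<phi> x) \<le> B"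
    using bounded_lift[OF assms(1)] by blast
  have "\<bar>\<phi> x\<bar> * \<bar>u x\<bar> \<le> \<bar>B\<bar> * \<bar>u x\<bar>" for x
    using B[of x] by (intro mult_right_mono) auto
  then show ?thesis
    using borel_measurable_lift[OF assms(1)] assms(2)
    by (intro Bochner_Integration.integrable_bound[OF integrable_mult_right[OF assms(2), of B]])
       (auto simp: abs_mult)
qed

text \<open>Trigonometric polynomials are smooth, so by Stone and Weierstrass orthogonality passes to
  continuous functions.\<close>

lemma integral_continuous_eq_0:
  fixes u :: "'n::finite torus \<Rightarrow> real"
  assumes u: "integrable torus_measure u"
    and orth: "\<And>\<phi>. smooth (\<phi> \<circ> torus_proj) \<Longrightarrow> (\<integral>x. \<phi> x * u x \<partial>torus_measure) = 0"
    and \<psi>: "continuous_on UNIV \<psi>"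
  shows "(\<integral>x. \<psi> (torus_embed x) * u x \<partial>torus_measure) = 0"
proof -
  have ce: "continuous_on UNIV (torus_embed \<circ> torus_proj :: real ^ 'n \<Rightarrow> _)"
    by (intro continuous_on_compose continuous_torus_proj
        continuous_on_subset[OF continuous_torus_embed subset_UNIV])
  have cx: "continuous_on UNIV ((\<lambda>x. \<psi> (torus_embed x)) \<circ> torus_proj :: real ^ 'n \<Rightarrow> _)"
    using continuous_on_compose2[OF \<psi> ce] by (simp add: comp_def)
  have bound: "\<bar>\<integral>x. \<psi> (torus_embed x) * u x \<partial>torus_measure\<bar> \<le> e * (\<integral>x. \<bar>u x\<bar> \<partial>torus_measure)"
    if "e > 0" for e
  proof -
    obtain g where g: "real_polynomial_function g"
      and close: "\<And>w. w \<in> range torus_embed \<Longrightarrow> \<bar>\<psi> w - g w\<bar> < e"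
      using Stone_Weierstrass_real_polynomial_function[OF
          compact_torus_embed_image[OF closed_UNIV] continuous_on_subset[OF \<psi> subset_UNIV] \<open>e > 0\<close>]
      by metis
    have sg: "smooth ((\<lambda>x. g (torus_embed x)) \<circ> torus_proj :: real ^ 'n \<Rightarrow> _)"
      by (rule smooth_polynomial_torus_embed[OF g])
    note ints = integrable_smooth_mult[OF cx u]
      integrable_smooth_mult[OF smooth_imp_continuous[OF sg] u]
    have "(\<integral>x. \<psi> (torus_embed x) * u x \<partial>torus_measure)
        = (\<integral>x. \<psi> (torus_embed x) * u x - g (torus_embed x) * u x \<partial>torus_measure)"
      using orth[OF sg] by (simp only: Bochner_Integration.integral_diff[OF ints] diff_0_right)
    also have "\<bar>\<dots>\<bar> \<le> (\<integral>x. \<bar>\<psi> (torus_embed x) * u x - g (torus_embed x) * u x\<bar> \<partial>torus_measure)"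
      by (rule integral_abs_bound)
    also have "\<dots> \<le> (\<integral>x. e * \<bar>u x\<bar> \<partial>torus_measure)"
    proof (rule integral_mono)
      show "integrable torus_measure (\<lambda>x. \<bar>\<psi> (torus_embed x) * u x - g (torus_embed x) * u x\<bar>)"
        using ints by auto
      show "\<bar>\<psi> (torus_embed x) * u x - g (torus_embed x) * u x\<bar> \<le> e * \<bar>u x\<bar>" for x
      proof -
        have "\<bar>\<psi> (torus_embed x) * u x - g (torus_embed x) * u x\<bar>
            = \<bar>\<psi> (torus_embed x) - g (torus_embed x)\<bar> * \<bar>u x\<bar>"
          by (simp add: abs_mult flip: left_diff_distrib)
        also have "\<dots> \<le> e * \<bar>u x\<bar>"
          using close[of "torus_embed x"] by (intro mult_right_mono) auto
        finally show ?thesis .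
      qed
    qed (use u in auto)
    finally show ?thesis by simp
  qed
  define I where "I = (\<integral>x. \<bar>u x\<bar> \<partial>torus_measure)"
  have "I \<ge> 0" unfolding I_def by simp
  note bound = bound[folded I_def]
  have "\<bar>\<integral>x. \<psi> (torus_embed x) * u x \<partial>torus_measure\<bar> \<le> e" if "e > 0" for e
  proof -
    \<comment> \<open>The denominator is \<open>I + 1\<close> because \<open>I\<close> may vanish.\<close>
    have "\<bar>\<integral>x. \<psi> (torus_embed x) * u x \<partial>torus_measure\<bar> \<le> e / (I + 1) * I"
      using that \<open>I \<ge> 0\<close> by (intro bound) simp
    also have "\<dots> \<le> e"
      using that \<open>I \<ge> 0\<close> by (simp add: field_simps)
    finally show ?thesis .
  qed
  then have "\<bar>\<integral>x. \<psi> (torus_embed x) * u x \<partial>torus_measure\<bar> \<le> 0"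
    by (rule field_le_epsilon) simp
  then show ?thesis
    by simp
qed

text \<open>The indicator of a closed set is a decreasing limit of continuous functions of the distance to its
  image under the embedding.\<close>

lemma integral_closed_eq_0:
  fixes u :: "'n::finite torus \<Rightarrow> real"
  assumes u: "integrable torus_measure u"
    and orth: "\<And>\<phi>. smooth (\<phi> \<circ> torus_proj) \<Longrightarrow> (\<integral>x. \<phi> x * u x \<partial>torus_measure) = 0"
    and C: "closed C"
  shows "(\<integral>x\<in>C. u x \<partial>torus_measure) = 0"
proof (cases "C = {}")
  case False
  define \<psi> where "\<psi> N w = max 0 (1 - real N * infdist w (torus_embed ` C))" for N w
  have cont: "continuous_on UNIV (\<psi> N)" for N
    unfolding \<psi>_def by (intro continuous_intros)
  have cl: "closed (torus_embed ` C)"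
    using compact_torus_embed_image[OF C] by (rule compact_imp_closed)
  have "(\<lambda>N. \<integral>x. \<psi> N (torus_embed x) * u x \<partial>torus_measure)
      \<longlonglongrightarrow> (\<integral>x. indicator C x * u x \<partial>torus_measure)"
  proof (rule integral_dominated_convergence)
    show "integrable torus_measure (\<lambda>x. \<bar>u x\<bar>)"
      using u by simp
    show "(\<lambda>x. indicator C x * u x) \<in> borel_measurable torus_measure"
      using u C by (intro borel_measurable_times borel_measurable_indicator) auto
    show "(\<lambda>x. \<psi> N (torus_embed x) * u x) \<in> borel_measurable torus_measure" for N
    proof -
      have "(\<lambda>x. \<psi> N (torus_embed x)) \<in> borel_measurable (borel :: 'n torus measure)"
        by (intro borel_measurable_continuous_onI
            continuous_on_compose2[OF cont continuous_torus_embed]) auto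
      then show ?thesis
        using u by (intro borel_measurable_times) auto
    qed
    show "AE x in torus_measure. norm (\<psi> N (torus_embed x) * u x) \<le> \<bar>u x\<bar>" for N
    proof (rule AE_I2)
      fix x
      have "\<bar>\<psi> N (torus_embed x)\<bar> \<le> 1"
        by (auto simp: \<psi>_def infdist_nonneg)
      then show "norm (\<psi> N (torus_embed x) * u x) \<le> \<bar>u x\<bar>"
        by (simp add: abs_mult mult_left_le_one_le)
    qed
    show "AE x in torus_measure.
        (\<lambda>N. \<psi> N (torus_embed x) * u x) \<longlonglongrightarrow> indicator C x * u x"
    proof (rule AE_I2, intro tendsto_mult tendsto_const)
      fix x :: "'n torus"
      show "(\<lambda>N. \<psi> N (torus_embed x)) \<longlonglongrightarrow> indicator C x"
      proof (cases "x \<in> C")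
        case True
        then show ?thesis by (simp add: \<psi>_def)
      next
        case x: False
        then have "torus_embed x \<notin> torus_embed ` C"
          using inj_torus_embed by (auto dest: injD)
        then have pos: "infdist (torus_embed x) (torus_embed ` C) > 0"
          using infdist_pos_not_in_closed[OF cl] False by auto
        obtain M :: nat where "1 / infdist (torus_embed x) (torus_embed ` C) \<le> real M"
          using real_arch_simple by blast
        then have M: "1 \<le> real M * infdist (torus_embed x) (torus_embed ` C)"
          using pos by (simp add: field_simps)
        have "\<psi> N (torus_embed x) = 0" if "N \<ge> M" for N
        proof -
          have "real M * infdist (torus_embed x) (torus_embed ` C)
              \<le> real N * infdist (torus_embed x) (torus_embed ` C)"
            using that pos by (intro mult_right_mono) auto
          with M show ?thesis by (simp add: \<psi>_def)
        qed
        then have "eventually (\<lambda>N. \<psi> N (torus_embed x) = 0) sequentially"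
          by (auto simp: eventually_sequentially)
        then show ?thesis
          using x by (simp add: tendsto_eventually)
      qed
    qed
  qed
  moreover have "(\<integral>x. \<psi> N (torus_embed x) * u x \<partial>torus_measure) = 0" for N
    by (rule integral_continuous_eq_0[OF u orth cont])
  ultimately have "(\<integral>x. indicator C x * u x \<partial>torus_measure) = 0"
    by (simp add: LIMSEQ_const_iff)
  then show ?thesis
    by (simp add: set_lebesgue_integral_def)
qed (simp add: set_lebesgue_integral_def)

text \<open>The fundamental lemma of the calculus of variations: closed sets are stable under intersection and
  generate the Borel sets, so the integral vanishes over every Borel set.\<close>

proposition AE_eq_0_if_orthogonal_to_smooth:
  fixes u :: "'n::finite torus \<Rightarrow> real"
  assumes u: "integrable torus_measure u"
    and orth: "\<And>\<phi>. smooth (\<phi> \<circ> torus_proj) \<Longrightarrow> (\<integral>x. \<phi> x * u x \<partial>torus_measure) = 0"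
  shows "AE x in torus_measure. u x = 0"
proof -
  interpret prob_space "torus_measure :: 'n torus measure"
    by (rule prob_space_torus_measure)
  have total: "(\<integral>x\<in>UNIV. u x \<partial>torus_measure) = 0"
    by (rule integral_closed_eq_0[OF u orth]) auto
  have setint: "set_integrable torus_measure A u" if "A \<in> sets borel" for A
    using that u unfolding set_integrable_def by (intro integrable_mult_indicator) auto
  have zero: "(\<integral>x\<in>A. u x \<partial>torus_measure) = 0" if "A \<in> sets borel" for A
  proof -
    have stable: "Int_stable (Collect closed :: 'n torus set set)"
      by (auto simp: Int_stable_def)
    have "A \<in> sigma_sets UNIV (Collect closed)"
      using that by (simp add: borel_eq_closed)
    have "Collect closed \<subseteq> Pow (UNIV :: 'n torus set)"
      by simp
    from stable this \<open>A \<in> sigma_sets UNIV (Collect closed)\<close> show ?thesis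
    proof (induction rule: sigma_sets_induct_disjoint)
      case (basic A)
      then show ?case by (auto intro: integral_closed_eq_0[OF u orth])
    next
      case empty
      show ?case by (simp add: set_lebesgue_integral_def)
    next
      case (compl A)
      then have A: "A \<in> sets borel" by (simp add: borel_eq_closed)
      have "(\<integral>x\<in>UNIV. u x \<partial>torus_measure)
          = (\<integral>x\<in>A. u x \<partial>torus_measure) + (\<integral>x\<in>UNIV - A. u x \<partial>torus_measure)"
        using A by (subst set_integral_Un[symmetric]) (auto intro!: setint)
      with total compl show ?case by simp
    next
      case (union A)
      then have A: "A i \<in> sets borel" for i by (auto simp: borel_eq_closed)
      have "(\<integral>x\<in>(\<Union>i. A i). u x \<partial>torus_measure) = (\<Sum>i. \<integral>x\<in>A i. u x \<partial>torus_measure)"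
        using A union by (intro lebesgue_integral_countable_add setint)
          (auto simp: disjoint_family_on_def)
      with union show ?case by simp
    qed
  qed
  show ?thesis
    using density_unique_real[of torus_measure u "\<lambda>_. 0"] u zero by auto
qed

section \<open>Translation invariance\<close>

text \<open>The half-open cubes of the integer lattice translated by \<open>a\<close>; the index \<open>k\<close> selects the one with lower corner
  \<open>a + k\<close>.\<close>

definition unit_cell :: "real ^ 'n::finite \<Rightarrow> ('n \<Rightarrow> int) \<Rightarrow> (real ^ 'n) set"
  where "unit_cell a k = {r. \<forall>i. \<lfloor>r $ i - a $ i\<rfloor> = k i}"

lemma sets_unit_cell [measurable]: "unit_cell a k \<in> sets borel"
proof -
  have [measurable]: "(\<lambda>r::real ^ 'n. r $ i) \<in> borel_measurable borel" for i
    by (intro borel_measurable_continuous_onI continuous_intros)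
  have "(\<lambda>r. \<lfloor>r $ i - a $ i\<rfloor>) -` {k i} \<inter> space borel \<in> sets borel" for i
    by measurable
  then have "(\<Inter>i. (\<lambda>r. \<lfloor>r $ i - a $ i\<rfloor>) -` {k i}) \<in> sets borel"
    by (intro sets.finite_INT) auto
  moreover have "unit_cell a k = (\<Inter>i. (\<lambda>r. \<lfloor>r $ i - a $ i\<rfloor>) -` {k i})"
    by (auto simp: unit_cell_def)
  ultimately show ?thesis by simp
qed

lemma emeasure_unit_cells:
  fixes \<sigma> :: "('n::finite \<Rightarrow> int) \<Rightarrow> 'n \<Rightarrow> int"
  assumes "A \<in> sets borel" "bij \<sigma>"
  shows "emeasure lborel A = (\<integral>\<^sup>+k. emeasure lborel (A \<inter> unit_cell a (\<sigma> k)) \<partial>count_space UNIV)"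
proof -
  have "r \<in> unit_cell a (\<sigma> (inv \<sigma> (\<lambda>i. \<lfloor>r $ i - a $ i\<rfloor>)))" for r
    using assms(2) by (simp add: unit_cell_def surj_f_inv_f bij_is_surj)
  then have "(\<Union>k. A \<inter> unit_cell a (\<sigma> k)) = A"
    by blast
  moreover have "disjoint_family (\<lambda>k. A \<inter> unit_cell a (\<sigma> k))"
  proof (unfold disjoint_family_on_def, intro ballI impI)
    fix k l :: "'n \<Rightarrow> int" assume "k \<noteq> l"
    then have "\<sigma> k \<noteq> \<sigma> l"
      using assms(2) by (auto dest: bij_is_inj injD)
    then show "(A \<inter> unit_cell a (\<sigma> k)) \<inter> (A \<inter> unit_cell a (\<sigma> l)) = {}"
      by (auto simp: unit_cell_def fun_eq_iff)
  qed
  ultimately show ?thesis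
    using emeasure_UN_countable[of UNIV "\<lambda>k. A \<inter> unit_cell a (\<sigma> k)" lborel] assms(1)
    by simp
qed

lemma emeasure_lborel_translate:
  assumes "S \<in> sets (borel :: 'a::euclidean_space measure)"
  shows "emeasure lborel S = emeasure lborel {r. c + r \<in> S}"
proof -
  have "emeasure lborel S = emeasure (distr lborel borel ((+) c)) S"
    by (simp add: lborel_distr_plus)
  also have "\<dots> = emeasure lborel ((+) c -` S \<inter> space lborel)"
    using assms by (intro emeasure_distr) auto
  finally show ?thesis by (simp add: vimage_def)
qed

text \<open>Every half-open unit cube is a fundamental domain. Cutting the cube at \<open>a\<close> along the cells of the
  lattice at \<open>0\<close>, and moving each piece by an integer vector into the cube at \<open>0\<close>, gives the cut of the
  latter along the cells of the lattice at \<open>a\<close>.\<close>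

lemma emeasure_periodic_unit_cell:
  fixes B :: "(real ^ 'n::finite) set"
  assumes B [measurable]: "B \<in> sets borel"
    and per: "\<And>r k. (\<forall>i. k $ i \<in> \<int>) \<Longrightarrow> k + r \<in> B \<longleftrightarrow> r \<in> B"
  shows "emeasure lborel (B \<inter> unit_cell a (\<lambda>_. 0)) = emeasure lborel (B \<inter> unit_cell 0 (\<lambda>_. 0))"
proof -
  have "emeasure lborel (B \<inter> unit_cell a (\<lambda>_. 0) \<inter> unit_cell 0 k)
      = emeasure lborel (B \<inter> unit_cell 0 (\<lambda>_. 0) \<inter> unit_cell a (- k))" for k
  proof -
    define kv :: "real ^ 'n" where "kv = (\<chi> i. of_int (k i))"
    have "{r. kv + r \<in> B \<inter> unit_cell a (\<lambda>_. 0) \<inter> unit_cell 0 k}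
        = B \<inter> unit_cell 0 (\<lambda>_. 0) \<inter> unit_cell a (- k)"
    proof -
      have "kv + r \<in> B \<longleftrightarrow> r \<in> B" for r
        by (rule per) (simp add: kv_def)
      moreover have "kv + r \<in> unit_cell 0 k \<longleftrightarrow> r \<in> unit_cell 0 (\<lambda>_. 0)" for r
        by (simp add: unit_cell_def kv_def)
      moreover have "kv + r \<in> unit_cell a (\<lambda>_. 0) \<longleftrightarrow> r \<in> unit_cell a (- k)" for r
      proof -
        have "\<lfloor>(kv + r) $ i - a $ i\<rfloor> = k i + \<lfloor>r $ i - a $ i\<rfloor>" for i
          using floor_add_int[of "r $ i - a $ i" "k i"] by (simp add: kv_def algebra_simps)
        then show ?thesis
          by (simp add: unit_cell_def) (metis add.inverse_unique add.right_inverse)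
      qed
      ultimately show ?thesis by auto
    qed
    then show ?thesis
      by (subst emeasure_lborel_translate[where c = kv]) auto
  qed
  moreover have "bij (uminus :: ('n \<Rightarrow> int) \<Rightarrow> _)"
    by (rule o_bij[of uminus]) (auto simp: fun_eq_iff)
  ultimately show ?thesis
    using emeasure_unit_cells[of "B \<inter> unit_cell a (\<lambda>_. 0)" "\<lambda>k. k" 0]
      emeasure_unit_cells[of "B \<inter> unit_cell 0 (\<lambda>_. 0)" uminus a]
    by (simp add: bij_def)
qed

text \<open>The faces of the cube are null, so the closed cube may be replaced by a half-open fundamental
  domain.\<close>

lemma emeasure_torus_measure:
  fixes A :: "'n::finite torus set"
  assumes A [measurable]: "A \<in> sets borel"
  shows "emeasure torus_measure A = emeasure lborel (torus_proj -` A \<inter> unit_cell 0 (\<lambda>_. 0))"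
proof -
  have B: "torus_proj -` A \<in> sets (borel :: (real ^ 'n) measure)"
    using measurable_sets[OF measurable_torus_proj A] by simp
  have "emeasure torus_measure A = emeasure lborel (torus_proj -` A \<inter> cbox 0 1)"
    using A unfolding torus_measure_def
    by (subst emeasure_distr)
       (auto simp: space_restrict_space emeasure_restrict_space measurable_restrict_space1)
  also have "\<dots> = emeasure lborel (torus_proj -` A \<inter> unit_cell 0 (\<lambda>_. 0))"
  proof (rule emeasure_eq_AE)
    have "emeasure lborel (cbox 0 1 :: (real ^ 'n) set) = 1"
      and "emeasure lborel (box 0 1 :: (real ^ 'n) set) = 1"
      by (simp_all add: emeasure_lborel_cbox_eq emeasure_lborel_box_eq Basis_vec_def inner_axis
          prod.neutral)
    then have "emeasure lborel (cbox 0 1 - box 0 1 :: (real ^ 'n) set) = 0"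
      by (subst emeasure_Diff) (auto simp: box_subset_cbox)
    then have "AE r in lborel. r \<notin> (cbox 0 1 - box 0 1 :: (real ^ 'n) set)"
      by (intro AE_not_in) (auto simp: null_sets_def)
    then show "AE r in lborel. r \<in> torus_proj -` A \<inter> cbox 0 1
        \<longleftrightarrow> r \<in> torus_proj -` A \<inter> unit_cell 0 (\<lambda>_. 0)"
    proof eventually_elim
      case (elim r)
      have "r \<in> unit_cell 0 (\<lambda>_. 0) \<longleftrightarrow> (\<forall>i. 0 \<le> r $ i \<and> r $ i < 1)"
        by (auto simp: unit_cell_def floor_eq_iff)
      with elim show ?case
        by (auto simp: mem_box_cart intro: less_imp_le)
    qed
  qed (use B in auto)
  finally show ?thesis .
qed

text \<open>Translation by a Euclidean vector. The choice of representative is immaterial, since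
  the projection is invariant under integer vectors; see \<open>torus_shift_proj\<close>.\<close>

definition torus_shift :: "real ^ 'n::finite \<Rightarrow> 'n torus \<Rightarrow> 'n torus"
  where "torus_shift h x = torus_proj (torus_rep x + h)"

lemma torus_shift_proj: "torus_shift h (torus_proj r) = torus_proj (r + h)"
  unfolding torus_shift_def by (rule torus_proj_add_cong) simp

lemma torus_shift_shift: "torus_shift a (torus_shift b x) = torus_shift (b + a) x"
  by (simp add: torus_shift_proj torus_shift_def[of b] torus_shift_def[of "b + a"] add.assoc)

lemma torus_shift_0 [simp]: "torus_shift 0 x = x"
  by (simp add: torus_shift_def)

lemma measurable_torus_shift [measurable (raw)]:
  assumes [measurable]: "f \<in> M \<rightarrow>\<^sub>M borel" "g \<in> M \<rightarrow>\<^sub>M borel"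
  shows "(\<lambda>\<omega>. torus_shift (f \<omega>) (g \<omega>)) \<in> M \<rightarrow>\<^sub>M borel"
  unfolding torus_shift_def by measurable

lemma distr_torus_shift:
  fixes a :: "real ^ 'n::finite"
  shows "distr torus_measure borel (torus_shift a) = torus_measure"
proof (rule measure_eqI)
  fix A :: "'n torus set"
  assume "A \<in> sets (distr torus_measure borel (torus_shift a))"
  then have A [measurable]: "A \<in> sets borel" by simp
  have B [measurable]: "torus_proj -` A \<in> sets (borel :: (real ^ 'n) measure)"
    using measurable_sets[OF measurable_torus_proj A] by simp
  have m: "torus_shift a \<in> borel \<rightarrow>\<^sub>M borel" by measurable
  then have A': "torus_shift a -` A \<in> sets borel"
    using measurable_sets[OF m A] by simp
  have "emeasure (distr torus_measure borel (torus_shift a)) A = emeasure torus_measure (torus_shift a -` A)"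
    using m by (subst emeasure_distr) (auto simp: measurable_cong_sets[OF sets_torus_measure refl])
  also have "\<dots> = emeasure lborel (torus_proj -` torus_shift a -` A \<inter> unit_cell 0 (\<lambda>_. 0))"
    by (rule emeasure_torus_measure[OF A'])
  also have "torus_proj -` torus_shift a -` A \<inter> unit_cell 0 (\<lambda>_. 0)
      = {r. a + r \<in> torus_proj -` A \<inter> unit_cell a (\<lambda>_. 0)}"
    by (auto simp: torus_shift_proj unit_cell_def add.commute)
  also have "emeasure lborel \<dots> = emeasure lborel (torus_proj -` A \<inter> unit_cell a (\<lambda>_. 0))"
    by (rule emeasure_lborel_translate[symmetric]) auto
  also have "\<dots> = emeasure lborel (torus_proj -` A \<inter> unit_cell 0 (\<lambda>_. 0))"
  proof (rule emeasure_periodic_unit_cell[OF B])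
    fix r k :: "real ^ 'n" assume "\<forall>i. k $ i \<in> \<int>"
    then have "torus_proj (k + r) = torus_proj r"
      by (simp add: torus_proj_eq_iff)
    then show "k + r \<in> torus_proj -` A \<longleftrightarrow> r \<in> torus_proj -` A" by simp
  qed
  also have "\<dots> = emeasure torus_measure A"
    by (rule emeasure_torus_measure[OF A, symmetric])
  finally show "emeasure (distr torus_measure borel (torus_shift a)) A = emeasure torus_measure A" .
qed simp

lemma integral_torus_shift:
  fixes f :: "'n::finite torus \<Rightarrow> 'b::{banach, second_countable_topology}"
  assumes "f \<in> borel_measurable borel"
  shows "(\<integral>x. f (torus_shift h x) \<partial>torus_measure) = (\<integral>x. f x \<partial>torus_measure)"
  by (subst (2) distr_torus_shift[of h, symmetric])
     (rule integral_distr[symmetric], use assms in measurable)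

lemma nn_integral_torus_shift:
  fixes f :: "'n::finite torus \<Rightarrow> ennreal"
  assumes "f \<in> borel_measurable borel"
  shows "(\<integral>\<^sup>+x. f (torus_shift h x) \<partial>torus_measure) = (\<integral>\<^sup>+x. f x \<partial>torus_measure)"
  by (subst (2) distr_torus_shift[of h, symmetric])
     (rule nn_integral_distr[symmetric], use assms in measurable)

section \<open>Square integrable functions\<close>

lemma square_integrable_measurable [measurable_dest]:
  "square_integrable M f \<Longrightarrow> f \<in> borel_measurable M"
  by (simp add: square_integrable_def)

lemma square_integrableD:
  "square_integrable M f \<Longrightarrow> integrable M (\<lambda>x. (norm (f x))\<^sup>2)"
  by (simp add: square_integrable_def)

lemma power2_norm_add_le:
  fixes a b :: "'b::real_inner"
  shows "(norm (a + b))\<^sup>2 \<le> 2 * (norm a)\<^sup>2 + 2 * (norm b)\<^sup>2"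
proof -
  have "(norm (a + b))\<^sup>2 + (norm (a - b))\<^sup>2 = 2 * (norm a)\<^sup>2 + 2 * (norm b)\<^sup>2"
    by (simp add: power2_norm_eq_inner algebra_simps inner_commute)
  then show ?thesis
    using zero_le_power2[of "norm (a - b)"] by linarith
qed

lemma square_integrable_bound:
  fixes f :: "'a \<Rightarrow> 'b::euclidean_space"
  assumes "f \<in> borel_measurable M" "integrable M w" "AE x in M. (norm (f x))\<^sup>2 \<le> w x"
  shows "square_integrable M f"
  unfolding square_integrable_def
  using assms by (auto intro!: Bochner_Integration.integrable_bound[OF assms(2)])

lemma square_integrable_scaleR:
  "square_integrable M f \<Longrightarrow> square_integrable M (\<lambda>x. c *\<^sub>R f x)"
  by (auto simp: square_integrable_def power_mult_distrib)

lemma square_integrable_add: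
  assumes "square_integrable M f" "square_integrable M g"
  shows "square_integrable M (\<lambda>x. f x + g x)"
  using assms
  by (intro square_integrable_bound[where w = "\<lambda>x. 2 * (norm (f x))\<^sup>2 + 2 * (norm (g x))\<^sup>2"])
     (auto simp: power2_norm_add_le square_integrable_def)

lemma square_integrable_diff:
  assumes "square_integrable M f" "square_integrable M g"
  shows "square_integrable M (\<lambda>x. f x - g x)"
  using square_integrable_add[OF assms(1) square_integrable_scaleR[OF assms(2), of "- 1"]] by simp

lemma (in finite_measure) square_integrable_imp_integrable:
  assumes "square_integrable M f"
  shows "integrable M f"
proof (rule Bochner_Integration.integrable_bound)
  show "integrable M (\<lambda>x. 1 + (norm (f x))\<^sup>2)"
    using assms by (simp add: square_integrable_def)
  have "norm (f x) \<le> 1 + (norm (f x))\<^sup>2" for x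
  proof -
    have "0 \<le> (norm (f x) - 1 / 2)\<^sup>2" by simp
    then show ?thesis by (simp add: power2_eq_square algebra_simps)
  qed
  then show "AE x in M. norm (f x) \<le> norm (1 + (norm (f x))\<^sup>2)"
    by simp
qed (use assms in measurable)

lemma (in prob_space) integral_norm_le_L2:
  assumes "square_integrable M f"
  shows "(\<integral>x. norm (f x) \<partial>M)\<^sup>2 \<le> (\<integral>x. (norm (f x))\<^sup>2 \<partial>M)"
proof -
  have "integrable M (\<lambda>x. norm (f x))" "integrable M (\<lambda>x. (norm (f x))\<^sup>2)"
    using square_integrable_imp_integrable[OF assms] square_integrableD[OF assms] by auto
  then show ?thesis
    using variance_eq[of "\<lambda>x. norm (f x)"] variance_positive[of "\<lambda>x. norm (f x)"] by simp
qed

lemma (in prob_space) norm_integral_le_L2: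
  assumes "square_integrable M f"
  shows "(norm (\<integral>x. f x \<partial>M))\<^sup>2 \<le> (\<integral>x. (norm (f x))\<^sup>2 \<partial>M)"
proof -
  have "(norm (\<integral>x. f x \<partial>M))\<^sup>2 \<le> (\<integral>x. norm (f x) \<partial>M)\<^sup>2"
    by (intro power_mono integral_norm_bound) simp
  also note integral_norm_le_L2[OF assms]
  finally show ?thesis .
qed

text \<open>Riesz and Fischer: a subsequence with geometrically decaying increments converges almost
  everywhere, and Fatou's lemma makes its limit a limit in \<open>L\<^sup>2\<close>.\<close>

lemma (in prob_space) square_integrable_complete:
  fixes F :: "nat \<Rightarrow> 'a \<Rightarrow> 'b::euclidean_space"
  assumes sq: "\<And>n. square_integrable M (F n)"
    and Cauchy: "\<And>e. e > 0 \<Longrightarrow> \<exists>N. \<forall>m\<ge>N. \<forall>n\<ge>N. (\<integral>x. (norm (F m x - F n x))\<^sup>2 \<partial>M) < e"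
  obtains f where "square_integrable M f"
    and "(\<lambda>n. \<integral>x. (norm (F n x - f x))\<^sup>2 \<partial>M) \<longlonglongrightarrow> 0"
proof -
  have [measurable]: "F n \<in> borel_measurable M" for n
    using sq by (rule square_integrable_measurable)
  have "\<forall>k. \<exists>N. \<forall>m\<ge>N. \<forall>n\<ge>N. (\<integral>x. (norm (F m x - F n x))\<^sup>2 \<partial>M) < (1 / 4) ^ k"
    by (intro allI Cauchy) simp
  then obtain s where s: "\<And>k m n. m \<ge> s k \<Longrightarrow> n \<ge> s k \<Longrightarrow>
      (\<integral>x. (norm (F m x - F n x))\<^sup>2 \<partial>M) < (1 / 4) ^ k"
    by metis
  \<comment> \<open>The partial sums dominate every earlier threshold, so each increment of the subsequence
    is at most \<open>2 ^ (- k)\<close> in \<open>L\<^sup>2\<close>.\<close>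
  define r where "r k = (\<Sum>j\<le>k. s j)" for k
  have r: "r k \<ge> s j" if "j \<le> k" for j k
    unfolding r_def using that by (intro member_le_sum) auto
  define D where "D k x = norm (F (r (Suc k)) x - F (r k) x)" for k x
  have D_int: "integrable M (D k)" and D_le: "(\<integral>x. D k x \<partial>M) \<le> (1 / 2) ^ k" for k
  proof -
    have sqd: "square_integrable M (\<lambda>x. F (r (Suc k)) x - F (r k) x)"
      by (intro square_integrable_diff sq)
    show "integrable M (D k)"
      unfolding D_def using square_integrable_imp_integrable[OF sqd] by simp
    have "(\<integral>x. D k x \<partial>M)\<^sup>2 \<le> (\<integral>x. (norm (F (r (Suc k)) x - F (r k) x))\<^sup>2 \<partial>M)"
      unfolding D_def by (rule integral_norm_le_L2[OF sqd])
    also have "\<dots> \<le> (1 / 4) ^ k"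
      by (rule less_imp_le, rule s; rule r) auto
    also have "\<dots> = ((1 / 2) ^ k)\<^sup>2"
      by (simp add: power_mult_distrib power2_eq_square flip: power_mult_distrib)
    finally show "(\<integral>x. D k x \<partial>M) \<le> (1 / 2) ^ k"
      by (rule power2_le_imp_le) simp
  qed
  have "(\<integral>\<^sup>+x. (\<Sum>k. ennreal (D k x)) \<partial>M) = (\<Sum>k. \<integral>\<^sup>+x. ennreal (D k x) \<partial>M)"
    unfolding D_def by (intro nn_integral_suminf) measurable
  also have "\<dots> \<le> (\<Sum>k. ennreal ((1 / 2) ^ k))"
  proof (intro suminf_le allI)
    fix k
    have "(\<integral>\<^sup>+x. ennreal (D k x) \<partial>M) = ennreal (\<integral>x. D k x \<partial>M)"
      by (intro nn_integral_eq_integral D_int) (simp add: D_def)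
    then show "(\<integral>\<^sup>+x. ennreal (D k x) \<partial>M) \<le> ennreal ((1 / 2) ^ k)"
      using D_le[of k] by (simp add: ennreal_leI)
  qed auto
  also have "\<dots> = ennreal (\<Sum>k. (1 / 2) ^ k)"
    by (intro suminf_ennreal2 summable_geometric) auto
  also have "\<dots> < top" by simp
  finally have "(\<integral>\<^sup>+x. (\<Sum>k. ennreal (D k x)) \<partial>M) \<noteq> top"
    by simp
  then have "AE x in M. (\<Sum>k. ennreal (D k x)) \<noteq> top"
    unfolding D_def by (rule nn_integral_PInf_AE[unfolded infinity_ennreal_def, rotated]) measurable
  then have conv: "AE x in M. convergent (\<lambda>k. F (r k) x)"
  proof eventually_elim
    case (elim x)
    then have "summable (\<lambda>k. D k x)"
      by (intro summable_suminf_not_top) (auto simp: D_def)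
    then have "summable (\<lambda>k. F (r (Suc k)) x - F (r k) x)"
      unfolding D_def by (rule summable_norm_cancel)
    then have "convergent (\<lambda>n. F (r n) x - F (r 0) x)"
      by (simp add: summable_iff_convergent sum_lessThan_telescope[of "\<lambda>k. F (r k) x"])
    then show ?case
      by (simp add: convergent_diff_const_right_iff)
  qed
  define f where "f x = lim (\<lambda>k. F (r k) x)" for x
  have [measurable]: "f \<in> borel_measurable M"
    unfolding f_def by (intro borel_measurable_lim_metric) measurable
  have lim: "AE x in M. (\<lambda>k. F (r k) x) \<longlonglongrightarrow> f x"
    using conv by eventually_elim (simp add: f_def convergent_LIMSEQ_iff)
  have fatou: "(\<integral>\<^sup>+x. ennreal ((norm (F n x - f x))\<^sup>2) \<partial>M) \<le> ennreal ((1 / 4) ^ j)"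
    if "n \<ge> s j" for n j
  proof -
    have "(\<integral>\<^sup>+x. ennreal ((norm (F n x - f x))\<^sup>2) \<partial>M)
        = (\<integral>\<^sup>+x. liminf (\<lambda>k. ennreal ((norm (F n x - F (r k) x))\<^sup>2)) \<partial>M)"
    proof (rule nn_integral_cong_AE)
      show "AE x in M. ennreal ((norm (F n x - f x))\<^sup>2)
          = liminf (\<lambda>k. ennreal ((norm (F n x - F (r k) x))\<^sup>2))"
        using lim
      proof eventually_elim
        case (elim x)
        then have "(\<lambda>k. ennreal ((norm (F n x - F (r k) x))\<^sup>2))
            \<longlonglongrightarrow> ennreal ((norm (F n x - f x))\<^sup>2)"
          by (intro tendsto_intros) auto
        then show ?case
          by (intro lim_imp_Liminf[symmetric]) auto
      qed
    qed
    also have "\<dots> \<le> liminf (\<lambda>k. \<integral>\<^sup>+x. ennreal ((norm (F n x - F (r k) x))\<^sup>2) \<partial>M)"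
      by (intro nn_integral_liminf) measurable
    also have "\<dots> \<le> ennreal ((1 / 4) ^ j)"
    proof (rule Liminf_le)
      show "\<forall>\<^sub>F k in sequentially.
          (\<integral>\<^sup>+x. ennreal ((norm (F n x - F (r k) x))\<^sup>2) \<partial>M) \<le> ennreal ((1 / 4) ^ j)"
        using eventually_ge_at_top[of j]
      proof eventually_elim
        case (elim k)
        have "(\<integral>\<^sup>+x. ennreal ((norm (F n x - F (r k) x))\<^sup>2) \<partial>M)
            = ennreal (\<integral>x. (norm (F n x - F (r k) x))\<^sup>2 \<partial>M)"
          by (intro nn_integral_eq_integral square_integrableD square_integrable_diff sq) simp
        then show ?case
          using s[OF that r[OF elim]] by (simp add: ennreal_leI)
      qed
    qed simp
    finally show ?thesis .
  qed
  have diff: "square_integrable M (\<lambda>x. F n x - f x)" if "n \<ge> s 0" for n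
    unfolding square_integrable_def
    using order_le_less_trans[OF fatou[OF that] ennreal_less_top]
    by (auto intro!: integrableI_bounded)
  show ?thesis
  proof (rule that)
    show "square_integrable M f"
      using square_integrable_diff[OF sq[of "s 0"] diff[of "s 0"]] by simp
    show "(\<lambda>n. \<integral>x. (norm (F n x - f x))\<^sup>2 \<partial>M) \<longlonglongrightarrow> 0"
    proof (rule LIMSEQ_I)
      fix e :: real assume "e > 0"
      then obtain j where j: "(1 / 4) ^ j < e"
        using real_arch_pow_inv[of e "1 / 4"] by auto
      have "norm ((\<integral>x. (norm (F n x - f x))\<^sup>2 \<partial>M) - 0) < e" if "n \<ge> s j" for n
      proof -
        have "(\<integral>x. (norm (F n x - f x))\<^sup>2 \<partial>M) \<le> (1 / 4) ^ j"
          by (intro integral_real_bounded fatou[OF that]) simp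
        with j show ?thesis by simp
      qed
      then show "\<exists>N. \<forall>n\<ge>N. norm ((\<integral>x. (norm (F n x - f x))\<^sup>2 \<partial>M) - 0) < e"
        by blast
    qed
  qed
qed

section \<open>The Poincare inequality\<close>

text \<open>A random translation, independent of the point it moves, preserves the torus measure. This turns
  integrability on the torus into integrability of translates on a product space, as the theorem
  of Fubini requires.\<close>

lemma distr_random_torus_shift:
  fixes a :: "'a \<Rightarrow> real ^ 'n::finite"
  assumes "prob_space P" and [measurable]: "a \<in> borel_measurable P"
  shows "distr (P \<Otimes>\<^sub>M torus_measure) borel (\<lambda>(\<omega>, x). torus_shift (a \<omega>) x) = torus_measure"
proof (rule measure_eqI)
  interpret P: prob_space P by fact
  interpret T: prob_space "torus_measure :: 'n torus measure" by (rule prob_space_torus_measure)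
  let ?S = "\<lambda>(\<omega>, x). torus_shift (a \<omega>) x"
  have m [measurable]: "?S \<in> (P \<Otimes>\<^sub>M torus_measure) \<rightarrow>\<^sub>M borel"
    by measurable
  fix A assume "A \<in> sets (distr (P \<Otimes>\<^sub>M torus_measure) borel ?S)"
  then have A [measurable]: "A \<in> sets borel" by simp
  have "emeasure (distr (P \<Otimes>\<^sub>M torus_measure) borel ?S) A
      = (\<integral>\<^sup>+y. indicator A y \<partial>distr (P \<Otimes>\<^sub>M torus_measure) borel ?S)"
    by simp
  also have "\<dots> = (\<integral>\<^sup>+p. indicator A (?S p) \<partial>(P \<Otimes>\<^sub>M torus_measure))"
    by (rule nn_integral_distr[OF m]) simp
  also have "\<dots> = (\<integral>\<^sup>+\<omega>. \<integral>\<^sup>+x. indicator A (torus_shift (a \<omega>) x) \<partial>torus_measure \<partial>P)"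
    by (subst T.nn_integral_fst[symmetric]) simp_all
  also have "\<dots> = (\<integral>\<^sup>+\<omega>. emeasure torus_measure A \<partial>P)"
    by (subst nn_integral_torus_shift) simp_all
  also have "\<dots> = emeasure torus_measure A"
    by (simp add: P.emeasure_space_1)
  finally show "emeasure (distr (P \<Otimes>\<^sub>M torus_measure) borel ?S) A = emeasure torus_measure A" .
qed simp

lemma random_torus_shift:
  fixes a :: "'a \<Rightarrow> real ^ 'n::finite" and w :: "'n torus \<Rightarrow> 'b::{banach, second_countable_topology}"
  assumes "prob_space P" and [measurable]: "a \<in> borel_measurable P"
    and w: "integrable torus_measure w"
  shows "integrable (P \<Otimes>\<^sub>M torus_measure) (\<lambda>(\<omega>, x). w (torus_shift (a \<omega>) x))"
    and "(\<integral>(\<omega>, x). w (torus_shift (a \<omega>) x) \<partial>(P \<Otimes>\<^sub>M torus_measure)) = (\<integral>x. w x \<partial>torus_measure)"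
proof -
  let ?S = "\<lambda>(\<omega>, x). torus_shift (a \<omega>) x"
  have m: "?S \<in> (P \<Otimes>\<^sub>M torus_measure) \<rightarrow>\<^sub>M borel"
    by measurable
  have wm: "w \<in> borel_measurable borel"
    using borel_measurable_integrable[OF w] by (simp add: measurable_cong_sets[OF sets_torus_measure refl])
  note D = distr_random_torus_shift[OF assms(1,2)]
  have "integrable (P \<Otimes>\<^sub>M torus_measure) (\<lambda>p. w (?S p))"
    using w unfolding integrable_distr_eq[OF m wm, symmetric] D .
  then show "integrable (P \<Otimes>\<^sub>M torus_measure) (\<lambda>(\<omega>, x). w (torus_shift (a \<omega>) x))"
    by (simp add: case_prod_beta')
  have "(\<integral>p. w (?S p) \<partial>(P \<Otimes>\<^sub>M torus_measure)) = (\<integral>x. w x \<partial>torus_measure)"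
    unfolding integral_distr[OF m wm, symmetric] D ..
  then show "(\<integral>(\<omega>, x). w (torus_shift (a \<omega>) x) \<partial>(P \<Otimes>\<^sub>M torus_measure)) = (\<integral>x. w x \<partial>torus_measure)"
    by (simp add: case_prod_beta')
qed

lemma integrable_bounded_scaleR:
  fixes f :: "'a \<Rightarrow> real" and w :: "'a \<Rightarrow> 'b::{banach, second_countable_topology}"
  assumes f: "integrable M f" and [measurable]: "w \<in> borel_measurable M"
    and bound: "\<And>x. x \<in> space M \<Longrightarrow> norm (w x) \<le> B"
  shows "integrable M (\<lambda>x. f x *\<^sub>R w x)"
proof (rule Bochner_Integration.integrable_bound)
  show "integrable M (\<lambda>x. B * \<bar>f x\<bar>)"
    using f by simp
  show "AE x in M. norm (f x *\<^sub>R w x) \<le> norm (B * \<bar>f x\<bar>)"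
  proof (rule AE_I2)
    fix x assume "x \<in> space M"
    then have "norm (w x) \<le> \<bar>B\<bar>"
      using bound by (meson abs_ge_self order_trans)
    then show "norm (f x *\<^sub>R w x) \<le> norm (B * \<bar>f x\<bar>)"
      using mult_left_mono[of "norm (w x)" "\<bar>B\<bar>" "\<bar>f x\<bar>"]
      by (simp add: abs_mult mult.commute)
  qed
qed (use borel_measurable_integrable[OF f] in measurable)

lemma torus_gradient_bounded_measurable:
  fixes \<phi> :: "'n::finite torus \<Rightarrow> real"
  assumes "smooth (\<phi> \<circ> torus_proj)"
  obtains B where "torus_gradient \<phi> \<in> borel_measurable borel" "\<And>x. norm (torus_gradient \<phi> x) \<le> B"
  using bounded_lift[OF torus_gradient_smooth(2)[OF assms]]
    borel_measurable_lift[OF torus_gradient_smooth(2)[OF assms]] by blast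

lemma smooth_torus_shift:
  assumes "smooth (\<phi> \<circ> torus_proj)"
  shows "smooth ((\<lambda>x. \<phi> (torus_shift a x)) \<circ> torus_proj)"
  using smooth_shift[OF assms, of a] by (simp add: comp_def torus_shift_proj)

lemma torus_gradient_shift:
  fixes \<phi> :: "'n::finite torus \<Rightarrow> real"
  assumes "smooth (\<phi> \<circ> torus_proj)"
  shows "torus_gradient (\<lambda>x. \<phi> (torus_shift a x)) x = torus_gradient \<phi> (torus_shift a x)"
proof -
  have "((\<lambda>r. (\<phi> \<circ> torus_proj) (r + a)) has_derivative
      (\<lambda>h. h \<bullet> torus_gradient \<phi> (torus_proj (torus_rep x + a)))) (at (torus_rep x))"
    by (rule has_derivative_compose[where f = "\<lambda>r. r + a" and f' = "\<lambda>h. h"])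
       (use torus_gradient_smooth(1)[OF assms, of "torus_rep x + a"] in
         \<open>auto intro!: derivative_eq_intros simp: gderiv_def comp_def\<close>)
  then have "GDERIV ((\<lambda>x. \<phi> (torus_shift a x)) \<circ> torus_proj) (torus_rep x)
      :> torus_gradient \<phi> (torus_shift a x)"
    by (simp add: gderiv_def comp_def torus_shift_proj torus_shift_def[of a x])
  from torus_gradient_eq[OF this] show ?thesis by simp
qed

lemma integrable_scaleR_torus_gradient:
  fixes f :: "'n::finite torus \<Rightarrow> real"
  assumes f: "integrable torus_measure f" and \<phi>: "smooth (\<phi> \<circ> torus_proj)"
  shows "integrable torus_measure (\<lambda>x. f x *\<^sub>R torus_gradient \<phi> x)"
proof -
  obtain B where "torus_gradient \<phi> \<in> borel_measurable borel" "\<And>x. norm (torus_gradient \<phi> x) \<le> B"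
    using torus_gradient_bounded_measurable[OF \<phi>] by blast
  then show ?thesis
    by (intro integrable_bounded_scaleR[OF f]) auto
qed

lemma integrable_smooth_scaleR:
  fixes g :: "'n::finite torus \<Rightarrow> 'b::{banach, second_countable_topology}"
  assumes \<phi>: "smooth (\<phi> \<circ> torus_proj)" and g: "integrable torus_measure g"
  shows "integrable torus_measure (\<lambda>x. \<phi> x *\<^sub>R g x)"
proof (rule Bochner_Integration.integrable_bound)
  show "integrable torus_measure (\<lambda>x. \<phi> x * norm (g x))"
    using g by (intro integrable_smooth_mult smooth_imp_continuous \<phi>) simp
  have "\<phi> \<in> borel_measurable borel"
    by (rule borel_measurable_lift[OF smooth_imp_continuous[OF \<phi>]])
  then show "(\<lambda>x. \<phi> x *\<^sub>R g x) \<in> borel_measurable torus_measure"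
    using borel_measurable_integrable[OF g] by measurable
qed simp

lemma has_weak_gradient_inner:
  fixes f :: "'n::finite torus \<Rightarrow> real"
  assumes f: "integrable torus_measure f" and g: "integrable torus_measure g"
    and wg: "has_weak_gradient f g" and \<phi>: "smooth (\<phi> \<circ> torus_proj)"
  shows "(\<integral>x. f x * (h \<bullet> torus_gradient \<phi> x) \<partial>torus_measure)
    = - (\<integral>x. \<phi> x * (h \<bullet> g x) \<partial>torus_measure)"
proof -
  have "(\<integral>x. f x * (h \<bullet> torus_gradient \<phi> x) \<partial>torus_measure)
      = h \<bullet> (\<integral>x. f x *\<^sub>R torus_gradient \<phi> x \<partial>torus_measure)"
    using integral_inner_right[of h, OF integrable_scaleR_torus_gradient[OF f \<phi>]] by simp
  also have "\<dots> = h \<bullet> - (\<integral>x. \<phi> x *\<^sub>R g x \<partial>torus_measure)"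
    using wg \<phi> by (simp add: has_weak_gradient_def)
  also have "\<dots> = - (\<integral>x. \<phi> x * (h \<bullet> g x) \<partial>torus_measure)"
    using integral_inner_right[of h, OF integrable_smooth_scaleR[OF \<phi> g]] by simp
  finally show ?thesis .
qed

text \<open>A pair \<open>(h, t)\<close> stands for the displacement \<open>t h\<close>, at time \<open>t\<close> of the segment from \<open>0\<close> to \<open>h\<close>.\<close>

definition displacement_measure :: "((real ^ 'n::finite) \<times> real) measure"
  where "displacement_measure = restrict_space lborel (cbox 0 1) \<Otimes>\<^sub>M restrict_space lborel {0..1}"

lemma prob_space_cube: "prob_space (restrict_space lborel (cbox 0 (1 :: real ^ 'n::finite)))"
  by (intro prob_spaceI)
     (simp add: emeasure_restrict_space space_restrict_space emeasure_lborel_cbox_eq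
       Basis_vec_def inner_axis prod.neutral)

lemma prob_space_unit_interval: "prob_space (restrict_space lborel {0..1 :: real})"
  by (intro prob_spaceI) (simp add: emeasure_restrict_space space_restrict_space)

lemma prob_space_displacement: "prob_space (displacement_measure :: ((real ^ 'n::finite) \<times> real) measure)"
  unfolding displacement_measure_def
  by (intro prob_space_pair prob_space_cube prob_space_unit_interval)

lemma measurable_displacement [measurable]:
  "fst \<in> displacement_measure \<rightarrow>\<^sub>M borel" "snd \<in> displacement_measure \<rightarrow>\<^sub>M borel"
  unfolding displacement_measure_def
  by (auto intro!: measurable_compose[OF measurable_fst] measurable_compose[OF measurable_snd]
      measurable_restrict_space1)

lemma norm_displacement_le:
  fixes \<omega> :: "(real ^ 'n::finite) \<times> real"
  assumes "\<omega> \<in> space displacement_measure"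
  shows "norm (fst \<omega>) \<le> real CARD('n)"
proof -
  have h: "0 \<le> fst \<omega> $ i \<and> fst \<omega> $ i \<le> 1" for i
    using assms by (auto simp: displacement_measure_def space_pair_measure space_restrict_space mem_box_cart)
  have "norm (fst \<omega>) \<le> (\<Sum>i\<in>UNIV. \<bar>fst \<omega> $ i\<bar>)"
    by (rule norm_le_l1_cart)
  also have "\<dots> \<le> (\<Sum>i\<in>(UNIV :: 'n set). 1)"
    using h by (intro sum_mono) auto
  finally show ?thesis by simp
qed

lemma torus_shift_FTC:
  fixes \<phi> :: "'n::finite torus \<Rightarrow> real"
  assumes \<phi>: "smooth (\<phi> \<circ> torus_proj)"
  shows "(\<integral>t. h \<bullet> torus_gradient \<phi> (torus_shift (t *\<^sub>R h) x) \<partial>restrict_space lborel {0..1})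
    = \<phi> (torus_shift h x) - \<phi> x"
proof -
  define r where "r = torus_rep x"
  have x: "x = torus_proj r" by (simp add: r_def)
  let ?f = "\<lambda>t. h \<bullet> torus_gradient \<phi> (torus_proj (r + t *\<^sub>R h))"
  have deriv: "DERIV (\<lambda>t. (\<phi> \<circ> torus_proj) (r + t *\<^sub>R h)) t :> ?f t" for t
  proof -
    have "((\<lambda>t. (\<phi> \<circ> torus_proj) (r + t *\<^sub>R h)) has_derivative
        (\<lambda>s. (s *\<^sub>R h) \<bullet> torus_gradient \<phi> (torus_proj (r + t *\<^sub>R h)))) (at t)"
      by (rule has_derivative_compose[where f = "\<lambda>t. r + t *\<^sub>R h" and f' = "\<lambda>s. s *\<^sub>R h"])
         (use torus_gradient_smooth(1)[OF \<phi>, of "r + t *\<^sub>R h"] in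
           \<open>auto intro!: derivative_eq_intros simp: gderiv_def comp_def\<close>)
    then show ?thesis
      by (rule has_derivative_imp_has_field_derivative) (simp add: mult.commute)
  qed
  have "continuous_on UNIV (\<lambda>t. (torus_gradient \<phi> \<circ> torus_proj) (r + t *\<^sub>R h))"
    by (rule continuous_on_compose2[OF torus_gradient_smooth(2)[OF \<phi>]])
       (auto intro!: continuous_intros)
  then have "continuous_on UNIV ?f"
    by (intro continuous_intros) (simp add: comp_def)
  then have "isCont ?f t" for t
    by (simp add: continuous_on_eq_continuous_at)
  then have "(\<integral>t. ?f t * indicator {0..1} t \<partial>lborel)
      = (\<phi> \<circ> torus_proj) (r + 1 *\<^sub>R h) - (\<phi> \<circ> torus_proj) (r + 0 *\<^sub>R h)"
    by (intro integral_FTC_Icc_real deriv) auto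
  then show ?thesis
    by (simp add: integral_restrict_space x torus_shift_proj mult.commute)
qed

text \<open>Translates of \<open>x\<close> by the vectors of the unit cube cover the torus uniformly.\<close>

lemma mean_torus_shift:
  fixes \<phi> :: "'n::finite torus \<Rightarrow> real"
  assumes [measurable]: "\<phi> \<in> borel_measurable borel"
  shows "(\<integral>h. \<phi> (torus_shift h x) \<partial>restrict_space lborel (cbox 0 1)) = (\<integral>y. \<phi> y \<partial>torus_measure)"
proof -
  have "(\<integral>y. \<phi> y \<partial>torus_measure) = (\<integral>y. \<phi> (torus_shift (torus_rep x) y) \<partial>torus_measure)"
    by (rule integral_torus_shift[symmetric]) fact
  also have "\<dots> = (\<integral>h. \<phi> (torus_shift (torus_rep x) (torus_proj h)) \<partial>restrict_space lborel (cbox 0 1))"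
    unfolding torus_measure_def
    by (rule integral_distr) (auto intro: measurable_restrict_space1)
  finally show ?thesis
    by (simp add: torus_shift_proj) (simp add: torus_shift_def add.commute)
qed

text \<open>The fundamental theorem of calculus gives \<open>\<phi>(x + h) - \<phi>(x)\<close> along the segment to \<open>x + h\<close>; averaging over
  \<open>h\<close> in the unit cube turns the first term into the mean of \<open>\<phi>\<close>.\<close>

lemma smooth_minus_mean:
  fixes \<phi> :: "'n::finite torus \<Rightarrow> real"
  assumes \<phi>: "smooth (\<phi> \<circ> torus_proj)"
  shows "(\<integral>\<omega>. fst \<omega> \<bullet> torus_gradient \<phi> (torus_shift (snd \<omega> *\<^sub>R fst \<omega>) x) \<partial>displacement_measure)
    = (\<integral>y. \<phi> y \<partial>torus_measure) - \<phi> x"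
proof -
  let ?Q = "restrict_space lborel (cbox 0 1) :: (real ^ 'n) measure"
  let ?I = "restrict_space lborel {0..1} :: real measure"
  interpret D: prob_space "displacement_measure :: ((real ^ 'n) \<times> real) measure"
    by (rule prob_space_displacement)
  interpret Q: prob_space ?Q by (rule prob_space_cube)
  interpret I: prob_space ?I by (rule prob_space_unit_interval)
  interpret QI: pair_sigma_finite ?Q ?I ..
  obtain B where [measurable]: "torus_gradient \<phi> \<in> borel_measurable borel"
    and B: "\<And>x. norm (torus_gradient \<phi> x) \<le> B"
    using torus_gradient_bounded_measurable[OF \<phi>] by blast
  have [measurable]: "\<phi> \<in> borel_measurable borel"
    by (rule borel_measurable_lift[OF smooth_imp_continuous[OF \<phi>]])
  obtain C where C: "\<And>x. norm (\<phi> x) \<le> C"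
    using bounded_lift[OF smooth_imp_continuous[OF \<phi>]] by blast
  let ?F = "\<lambda>\<omega>. fst \<omega> \<bullet> torus_gradient \<phi> (torus_shift (snd \<omega> *\<^sub>R fst \<omega>) x)"
  have int: "integrable displacement_measure ?F"
  proof (rule D.integrable_const_bound[where B = "real CARD('n) * B"])
    have "norm (?F \<omega>) \<le> real CARD('n) * B" if "\<omega> \<in> space displacement_measure" for \<omega>
    proof -
      have "norm (?F \<omega>) \<le> norm (fst \<omega>) * norm (torus_gradient \<phi> (torus_shift (snd \<omega> *\<^sub>R fst \<omega>) x))"
        by (simp add: Cauchy_Schwarz_ineq2)
      also have "\<dots> \<le> real CARD('n) * B"
        by (intro mult_mono norm_displacement_le that B) auto
      finally show ?thesis .
    qed
    then show "AE \<omega> in displacement_measure. norm (?F \<omega>) \<le> real CARD('n) * B"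
      by (rule AE_I2)
  qed measurable
  then have "integrable (?Q \<Otimes>\<^sub>M ?I) (\<lambda>(h, t). h \<bullet> torus_gradient \<phi> (torus_shift (t *\<^sub>R h) x))"
    by (simp add: displacement_measure_def case_prod_beta')
  from QI.integral_fst[OF this]
  have "(\<integral>\<omega>. ?F \<omega> \<partial>displacement_measure)
      = (\<integral>h. \<integral>t. h \<bullet> torus_gradient \<phi> (torus_shift (t *\<^sub>R h) x) \<partial>?I \<partial>?Q)"
    by (simp add: displacement_measure_def case_prod_beta')
  also have "\<dots> = (\<integral>h. \<phi> (torus_shift h x) - \<phi> x \<partial>?Q)"
    by (simp add: torus_shift_FTC[OF \<phi>])
  also have "\<dots> = (\<integral>h. \<phi> (torus_shift h x) \<partial>?Q) - (\<integral>h. \<phi> x \<partial>?Q)"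
  proof (rule Bochner_Integration.integral_diff)
    have id: "(\<lambda>h. h) \<in> ?Q \<rightarrow>\<^sub>M borel"
      by (intro measurable_restrict_space1) simp
    show "integrable ?Q (\<lambda>h. \<phi> (torus_shift h x))"
      using C id by (intro Q.integrable_const_bound[where B = C]) auto
  qed simp
  also have "\<dots> = (\<integral>y. \<phi> y \<partial>torus_measure) - \<phi> x"
    using Q.prob_space by (simp add: mean_torus_shift space_restrict_space)
  finally show ?thesis .
qed

text \<open>The adjoint of \<open>smooth_minus_mean\<close>: tested against a smooth \<open>\<phi>\<close>, the right-hand side becomes \<open>- f\<close>
  tested against the average of \<open>h \<bullet> \<nabla>\<phi>(x + t h)\<close>, that is, against the mean of \<open>\<phi>\<close> minus \<open>\<phi>\<close>. The mean
  of \<open>\<phi>\<close> contributes nothing because \<open>f\<close> has mean zero.\<close>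

lemma displacement_representation:
  fixes f :: "'n::finite torus \<Rightarrow> real"
  assumes f: "integrable torus_measure f" and g: "integrable torus_measure g"
    and wg: "has_weak_gradient f g" and mean: "(\<integral>x. f x \<partial>torus_measure) = 0"
  shows "AE x in torus_measure.
    f x = (\<integral>\<omega>. fst \<omega> \<bullet> g (torus_shift (- (snd \<omega> *\<^sub>R fst \<omega>)) x) \<partial>displacement_measure)"
proof -
  let ?D = "displacement_measure :: ((real ^ 'n) \<times> real) measure"
  let ?T = "torus_measure :: 'n torus measure"
  interpret D: prob_space ?D by (rule prob_space_displacement)
  interpret T: prob_space ?T by (rule prob_space_torus_measure)
  interpret DT: pair_sigma_finite ?D ?T ..
  have [measurable]: "f \<in> borel_measurable borel" "g \<in> borel_measurable borel"
    using borel_measurable_integrable[OF f] borel_measurable_integrable[OF g]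
    by (simp_all add: measurable_cong_sets[OF sets_torus_measure refl])
  let ?G = "\<lambda>\<omega> x. fst \<omega> \<bullet> g (torus_shift (- (snd \<omega> *\<^sub>R fst \<omega>)) x)"
  have shifted: "integrable (?D \<Otimes>\<^sub>M ?T) (\<lambda>(\<omega>, x). g (torus_shift (- (snd \<omega> *\<^sub>R fst \<omega>)) x))"
    by (rule random_torus_shift(1)[OF prob_space_displacement _ g]) measurable
  have G_int: "integrable (?D \<Otimes>\<^sub>M ?T) (\<lambda>(\<omega>, x). \<psi> x * ?G \<omega> x)"
    if [measurable]: "\<psi> \<in> borel_measurable borel" and C: "\<And>x. norm (\<psi> x) \<le> C" for \<psi> :: "'n torus \<Rightarrow> real" and C
  proof (rule Bochner_Integration.integrable_bound)
    let ?n = "\<lambda>(\<omega>, x). norm (g (torus_shift (- (snd \<omega> *\<^sub>R fst \<omega>)) x))"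
    show "integrable (?D \<Otimes>\<^sub>M ?T) (\<lambda>p. C * (real CARD('n) * ?n p))"
      using integrable_norm[OF shifted] by (intro integrable_mult_right) (simp add: case_prod_beta')
    show "AE p in ?D \<Otimes>\<^sub>M ?T. norm ((\<lambda>(\<omega>, x). \<psi> x * ?G \<omega> x) p) \<le> norm (C * (real CARD('n) * ?n p))"
    proof (rule AE_I2)
      fix p assume "p \<in> space (?D \<Otimes>\<^sub>M ?T)"
      then have p: "fst p \<in> space ?D" by (auto simp: space_pair_measure)
      have "\<bar>?G (fst p) (snd p)\<bar> \<le> norm (fst (fst p)) * ?n p"
        by (simp add: case_prod_beta' Cauchy_Schwarz_ineq2)
      also have "\<dots> \<le> real CARD('n) * ?n p"
        by (intro mult_right_mono norm_displacement_le p) (simp add: case_prod_beta')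
      finally have "\<bar>\<psi> (snd p)\<bar> * \<bar>?G (fst p) (snd p)\<bar> \<le> C * (real CARD('n) * ?n p)"
        using C[of "snd p"] C[THEN order_trans[OF norm_ge_zero]] by (intro mult_mono) auto
      also have "\<dots> \<le> norm (C * (real CARD('n) * ?n p))" by simp
      finally show "norm ((\<lambda>(\<omega>, x). \<psi> x * ?G \<omega> x) p) \<le> norm (C * (real CARD('n) * ?n p))"
        by (simp add: case_prod_beta' abs_mult)
    qed
  qed measurable
  define v where "v x = (\<integral>\<omega>. ?G \<omega> x \<partial>?D)" for x
  have v_int: "integrable ?T v"
    using DT.integrable_snd[OF G_int[of "\<lambda>_. 1" 1]] by (simp add: v_def[abs_def])
  have orth: "(\<integral>x. \<phi> x * (f x - v x) \<partial>?T) = 0" if \<phi>: "smooth (\<phi> \<circ> torus_proj)" for \<phi>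
  proof -
    have [measurable]: "\<phi> \<in> borel_measurable borel"
      by (rule borel_measurable_lift[OF smooth_imp_continuous[OF \<phi>]])
    obtain C where C: "\<And>x. norm (\<phi> x) \<le> C"
      using bounded_lift[OF smooth_imp_continuous[OF \<phi>]] by blast
    obtain B where [measurable]: "torus_gradient \<phi> \<in> borel_measurable borel"
      and B: "\<And>x. norm (torus_gradient \<phi> x) \<le> B"
      using torus_gradient_bounded_measurable[OF \<phi>] by blast
    let ?H = "\<lambda>\<omega> x. fst \<omega> \<bullet> torus_gradient \<phi> (torus_shift (snd \<omega> *\<^sub>R fst \<omega>) x)"
    have fst_T: "integrable (?D \<Otimes>\<^sub>M ?T) (\<lambda>p. f (snd p))"
      using random_torus_shift(1)[OF prob_space_displacement, of "\<lambda>_. 0" f] f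
      by (simp add: case_prod_beta')
    have H_int: "integrable (?D \<Otimes>\<^sub>M ?T) (\<lambda>(\<omega>, x). f x * ?H \<omega> x)"
    proof -
      have "integrable (?D \<Otimes>\<^sub>M ?T) (\<lambda>p. f (snd p) *\<^sub>R ?H (fst p) (snd p))"
      proof (rule integrable_bounded_scaleR[OF fst_T])
        fix p assume "p \<in> space (?D \<Otimes>\<^sub>M ?T)"
        then have p: "fst p \<in> space ?D" by (auto simp: space_pair_measure)
        have "norm (?H (fst p) (snd p)) \<le> norm (fst (fst p)) *
            norm (torus_gradient \<phi> (torus_shift (snd (fst p) *\<^sub>R fst (fst p)) (snd p)))"
          by (simp add: Cauchy_Schwarz_ineq2)
        also have "\<dots> \<le> real CARD('n) * B"
          by (intro mult_mono norm_displacement_le p B) auto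
        finally show "norm (?H (fst p) (snd p)) \<le> real CARD('n) * B" .
      qed measurable
      then show ?thesis by (simp add: case_prod_beta')
    qed
    have \<phi>f: "integrable ?T (\<lambda>x. \<phi> x * f x)" and \<phi>v: "integrable ?T (\<lambda>x. \<phi> x * v x)"
      by (intro integrable_smooth_mult[OF smooth_imp_continuous[OF \<phi>]] f v_int)+
    have "(\<integral>x. \<phi> x * v x \<partial>?T) = (\<integral>x. \<integral>\<omega>. \<phi> x * ?G \<omega> x \<partial>?D \<partial>?T)"
      by (simp add: v_def)
    also have "\<dots> = (\<integral>\<omega>. \<integral>x. \<phi> x * ?G \<omega> x \<partial>?T \<partial>?D)"
      by (rule DT.Fubini_integral[OF G_int[OF _ C]]) measurable
    also have "\<dots> = (\<integral>\<omega>. - (\<integral>x. f x * ?H \<omega> x \<partial>?T) \<partial>?D)"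
    proof (rule Bochner_Integration.integral_cong[OF refl])
      fix \<omega> :: "(real ^ 'n) \<times> real"
      let ?a = "snd \<omega> *\<^sub>R fst \<omega>"
      have "(\<integral>x. \<phi> x * ?G \<omega> x \<partial>?T)
          = (\<integral>x. (\<lambda>x. \<phi> (torus_shift ?a x) * (fst \<omega> \<bullet> g x)) (torus_shift (- ?a) x) \<partial>?T)"
        by (simp add: torus_shift_shift)
      also have "\<dots> = (\<integral>x. \<phi> (torus_shift ?a x) * (fst \<omega> \<bullet> g x) \<partial>?T)"
        by (rule integral_torus_shift) measurable
      also have "\<dots> = - (\<integral>x. f x * ?H \<omega> x \<partial>?T)"
        using has_weak_gradient_inner[OF f g wg smooth_torus_shift[OF \<phi>, of ?a], of "fst \<omega>"]
        by (simp add: torus_gradient_shift[OF \<phi>])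
      finally show "(\<integral>x. \<phi> x * ?G \<omega> x \<partial>?T) = - (\<integral>x. f x * ?H \<omega> x \<partial>?T)" .
    qed
    also have "\<dots> = - (\<integral>x. \<integral>\<omega>. f x * ?H \<omega> x \<partial>?D \<partial>?T)"
      using DT.Fubini_integral[OF H_int] by simp
    also have "\<dots> = - (\<integral>x. f x * ((\<integral>y. \<phi> y \<partial>?T) - \<phi> x) \<partial>?T)"
      by (simp add: smooth_minus_mean[OF \<phi>])
    also have "\<dots> = (\<integral>x. \<phi> x * f x \<partial>?T) - (\<integral>y. \<phi> y \<partial>?T) * (\<integral>x. f x \<partial>?T)"
    proof -
      have "(\<integral>x. f x * ((\<integral>y. \<phi> y \<partial>?T) - \<phi> x) \<partial>?T)
          = (\<integral>x. (\<integral>y. \<phi> y \<partial>?T) * f x - \<phi> x * f x \<partial>?T)"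
        by (simp add: algebra_simps)
      then show ?thesis
        using f \<phi>f by simp
    qed
    finally have "(\<integral>x. \<phi> x * v x \<partial>?T) = (\<integral>x. \<phi> x * f x \<partial>?T)"
      using mean by simp
    then show ?thesis
      using \<phi>f \<phi>v by (simp add: right_diff_distrib)
  qed
  have "AE x in ?T. f x - v x = 0"
    by (rule AE_eq_0_if_orthogonal_to_smooth[OF _ orth]) (use f v_int in auto)
  then show ?thesis
    by (simp add: v_def)
qed

text \<open>Displacements in the unit cube are at most \<open>CARD('n)\<close> long, and shifting \<open>g\<close> does not change its
  norm, so the Jensen inequality applied to \<open>displacement_representation\<close> gives the bound.\<close>

proposition torus_Poincare:
  fixes f :: "'n::finite torus \<Rightarrow> real"
  assumes f: "square_integrable torus_measure f" and g: "square_integrable torus_measure g"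
    and wg: "has_weak_gradient f g" and mean: "(\<integral>x. f x \<partial>torus_measure) = 0"
  shows "(\<integral>x. (norm (f x))\<^sup>2 \<partial>torus_measure)
    \<le> (real CARD('n))\<^sup>2 * (\<integral>x. (norm (g x))\<^sup>2 \<partial>torus_measure)"
proof -
  let ?D = "displacement_measure :: ((real ^ 'n) \<times> real) measure"
  let ?T = "torus_measure :: 'n torus measure"
  interpret D: prob_space ?D by (rule prob_space_displacement)
  interpret T: prob_space ?T by (rule prob_space_torus_measure)
  interpret DT: pair_sigma_finite ?D ?T ..
  have [measurable]: "g \<in> borel_measurable borel"
    using square_integrable_measurable[OF g]
    by (simp add: measurable_cong_sets[OF sets_torus_measure refl])
  let ?g = "\<lambda>\<omega> x. g (torus_shift (- (snd \<omega> *\<^sub>R fst \<omega>)) x)"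
  let ?N = "\<lambda>\<omega> x. (norm (?g \<omega> x))\<^sup>2"
  have N_int: "integrable (?D \<Otimes>\<^sub>M ?T) (\<lambda>(\<omega>, x). ?N \<omega> x)"
    and N_eq: "(\<integral>(\<omega>, x). ?N \<omega> x \<partial>(?D \<Otimes>\<^sub>M ?T)) = (\<integral>x. (norm (g x))\<^sup>2 \<partial>?T)"
    using random_torus_shift[OF prob_space_displacement _ square_integrableD[OF g],
        of "\<lambda>\<omega>. - (snd \<omega> *\<^sub>R fst \<omega>)"]
    by simp_all
  have "AE x in ?T. (norm (f x))\<^sup>2 \<le> (real CARD('n))\<^sup>2 * (\<integral>\<omega>. ?N \<omega> x \<partial>?D)"
    using DT.AE_integrable_snd[OF N_int]
      displacement_representation[OF T.square_integrable_imp_integrable[OF f]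
        T.square_integrable_imp_integrable[OF g] wg mean]
  proof eventually_elim
    case (elim x)
    have bound: "(norm (fst \<omega> \<bullet> ?g \<omega> x))\<^sup>2 \<le> (real CARD('n))\<^sup>2 * ?N \<omega> x"
      if "\<omega> \<in> space ?D" for \<omega>
    proof -
      have "norm (fst \<omega> \<bullet> ?g \<omega> x) \<le> norm (fst \<omega>) * norm (?g \<omega> x)"
        by (simp add: Cauchy_Schwarz_ineq2)
      also have "\<dots> \<le> real CARD('n) * norm (?g \<omega> x)"
        by (intro mult_right_mono norm_displacement_le that) simp
      finally have "(norm (fst \<omega> \<bullet> ?g \<omega> x))\<^sup>2 \<le> (real CARD('n) * norm (?g \<omega> x))\<^sup>2"
        by (intro power_mono) auto
      then show ?thesis by (simp add: power_mult_distrib)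
    qed
    have int: "integrable ?D (\<lambda>\<omega>. (real CARD('n))\<^sup>2 * ?N \<omega> x)"
      using elim(1) by simp
    have sq: "square_integrable ?D (\<lambda>\<omega>. fst \<omega> \<bullet> ?g \<omega> x)"
      by (rule square_integrable_bound[OF _ int]) (measurable, use bound in auto)
    have "(norm (f x))\<^sup>2 = (norm (\<integral>\<omega>. fst \<omega> \<bullet> ?g \<omega> x \<partial>?D))\<^sup>2"
      using elim(2) by simp
    also have "\<dots> \<le> (\<integral>\<omega>. (norm (fst \<omega> \<bullet> ?g \<omega> x))\<^sup>2 \<partial>?D)"
      by (rule D.norm_integral_le_L2[OF sq])
    also have "\<dots> \<le> (\<integral>\<omega>. (real CARD('n))\<^sup>2 * ?N \<omega> x \<partial>?D)"
      by (rule integral_mono[OF square_integrableD[OF sq] int bound])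
    finally show ?case by simp
  qed
  then have "(\<integral>x. (norm (f x))\<^sup>2 \<partial>?T) \<le> (\<integral>x. (real CARD('n))\<^sup>2 * (\<integral>\<omega>. ?N \<omega> x \<partial>?D) \<partial>?T)"
    using DT.integrable_snd[OF N_int] square_integrableD[OF f] by (intro integral_mono_AE) auto
  also have "\<dots> = (real CARD('n))\<^sup>2 * (\<integral>x. (norm (g x))\<^sup>2 \<partial>?T)"
    using DT.integral_snd[OF N_int] N_eq by simp
  finally show ?thesis .
qed

section \<open>Mean-zero Sobolev functions\<close>

lemma has_weak_gradient_unique:
  fixes f :: "'n::finite torus \<Rightarrow> real"
  assumes f: "integrable torus_measure f"
    and g: "integrable torus_measure g" "has_weak_gradient f g"
    and g': "integrable torus_measure g'" "has_weak_gradient f g'"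
  shows "AE x in torus_measure. g x = g' x"
proof -
  have "AE x in torus_measure. axis i 1 \<bullet> (g x - g' x) = 0" for i
  proof (rule AE_eq_0_if_orthogonal_to_smooth)
    have gi: "integrable torus_measure (\<lambda>x. axis i 1 \<bullet> g x)"
      and gi': "integrable torus_measure (\<lambda>x. axis i 1 \<bullet> g' x)"
      using g g' by auto
    then show "integrable torus_measure (\<lambda>x. axis i 1 \<bullet> (g x - g' x))"
      by (simp add: inner_diff_right)
    fix \<phi> :: "'n torus \<Rightarrow> real" assume \<phi>: "smooth (\<phi> \<circ> torus_proj)"
    have "(\<integral>x. \<phi> x * (axis i 1 \<bullet> g x) \<partial>torus_measure) = (\<integral>x. \<phi> x * (axis i 1 \<bullet> g' x) \<partial>torus_measure)"
      using has_weak_gradient_inner[OF f g \<phi>, of "axis i 1"]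
        has_weak_gradient_inner[OF f g' \<phi>, of "axis i 1"] by simp
    then show "(\<integral>x. \<phi> x * (axis i 1 \<bullet> (g x - g' x)) \<partial>torus_measure) = 0"
      using integrable_smooth_mult[OF smooth_imp_continuous[OF \<phi>] gi]
        integrable_smooth_mult[OF smooth_imp_continuous[OF \<phi>] gi']
      by (simp add: inner_diff_right right_diff_distrib)
  qed
  then have "AE x in torus_measure. \<forall>i\<in>UNIV. axis i 1 \<bullet> (g x - g' x) = 0"
    by (intro AE_finite_allI) auto
  then show ?thesis
    by eventually_elim (simp add: vec_eq_iff inner_axis')
qed

lemma integral_linear_combination:
  fixes u v :: "'a \<Rightarrow> 'b::{banach, second_countable_topology}"
  assumes "integrable M u" "integrable M v"
  shows "(\<integral>x. a *\<^sub>R u x + b *\<^sub>R v x \<partial>M) = a *\<^sub>R (\<integral>x. u x \<partial>M) + b *\<^sub>R (\<integral>x. v x \<partial>M)"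
proof -
  have "integrable M (\<lambda>x. a *\<^sub>R u x)" "integrable M (\<lambda>x. b *\<^sub>R v x)"
    using assms by auto
  then show ?thesis by simp
qed

lemma has_weak_gradient_linear_combination:
  fixes f f' :: "'n::finite torus \<Rightarrow> real"
  assumes ints: "integrable torus_measure f" "integrable torus_measure g"
      "integrable torus_measure f'" "integrable torus_measure g'"
    and wg: "has_weak_gradient f g" and wg': "has_weak_gradient f' g'"
  shows "has_weak_gradient (\<lambda>x. a * f x + b * f' x) (\<lambda>x. a *\<^sub>R g x + b *\<^sub>R g' x)"
  unfolding has_weak_gradient_def
proof (intro allI impI)
  fix \<phi> :: "'n torus \<Rightarrow> real" assume \<phi>: "smooth (\<phi> \<circ> torus_proj)"
  note f = integrable_scaleR_torus_gradient[OF ints(1) \<phi>] integrable_scaleR_torus_gradient[OF ints(3) \<phi>]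
  note g = integrable_smooth_scaleR[OF \<phi> ints(2)] integrable_smooth_scaleR[OF \<phi> ints(4)]
  have "(\<integral>x. (a * f x + b * f' x) *\<^sub>R torus_gradient \<phi> x \<partial>torus_measure)
      = (\<integral>x. a *\<^sub>R (f x *\<^sub>R torus_gradient \<phi> x) + b *\<^sub>R (f' x *\<^sub>R torus_gradient \<phi> x) \<partial>torus_measure)"
    by (simp add: scaleR_left_distrib)
  also have "\<dots> = a *\<^sub>R (\<integral>x. f x *\<^sub>R torus_gradient \<phi> x \<partial>torus_measure)
      + b *\<^sub>R (\<integral>x. f' x *\<^sub>R torus_gradient \<phi> x \<partial>torus_measure)"
    by (rule integral_linear_combination[OF f])
  also have "\<dots> = - (a *\<^sub>R (\<integral>x. \<phi> x *\<^sub>R g x \<partial>torus_measure) + b *\<^sub>R (\<integral>x. \<phi> x *\<^sub>R g' x \<partial>torus_measure))"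
    using wg wg' \<phi> by (simp add: has_weak_gradient_def)
  also have "\<dots> = - (\<integral>x. a *\<^sub>R (\<phi> x *\<^sub>R g x) + b *\<^sub>R (\<phi> x *\<^sub>R g' x) \<partial>torus_measure)"
    by (simp only: integral_linear_combination[OF g])
  finally show "(\<integral>x. (a * f x + b * f' x) *\<^sub>R torus_gradient \<phi> x \<partial>torus_measure)
      = - (\<integral>x. \<phi> x *\<^sub>R (a *\<^sub>R g x + b *\<^sub>R g' x) \<partial>torus_measure)"
    by (simp add: scaleR_right_distrib mult.commute)
qed

lemma (in prob_space) L2_limit_imp_L1_limit:
  fixes f :: "'a \<Rightarrow> 'b::euclidean_space"
  assumes "\<And>n. square_integrable M (F n)" "square_integrable M f"
    and lim: "(\<lambda>n. \<integral>x. (norm (F n x - f x))\<^sup>2 \<partial>M) \<longlonglongrightarrow> 0"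
  shows "(\<lambda>n. \<integral>x. norm (F n x - f x) \<partial>M) \<longlonglongrightarrow> 0"
proof (rule tendsto_sandwich[of "\<lambda>_. 0"])
  show "\<forall>\<^sub>F n in sequentially. (\<integral>x. norm (F n x - f x) \<partial>M)
      \<le> sqrt (\<integral>x. (norm (F n x - f x))\<^sup>2 \<partial>M)"
    by (intro always_eventually allI real_le_rsqrt integral_norm_le_L2 square_integrable_diff assms)
  show "(\<lambda>n. sqrt (\<integral>x. (norm (F n x - f x))\<^sup>2 \<partial>M)) \<longlonglongrightarrow> 0"
    using tendsto_real_sqrt[OF lim] by simp
qed auto

lemma integral_bounded_times_tendsto:
  fixes H :: "nat \<Rightarrow> 'a \<Rightarrow> 'b::{banach, second_countable_topology}"
  assumes int: "\<And>n. integrable M (H n)" "integrable M h"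
    and e: "\<And>n. integrable M (e n)" and le: "\<And>n x. norm (H n x - h x) \<le> B * e n x"
    and lim: "(\<lambda>n. \<integral>x. e n x \<partial>M) \<longlonglongrightarrow> 0"
  shows "(\<lambda>n. \<integral>x. H n x \<partial>M) \<longlonglongrightarrow> (\<integral>x. h x \<partial>M)"
proof (rule LIM_zero_cancel, rule Lim_null_comparison)
  show "\<forall>\<^sub>F n in sequentially. norm ((\<integral>x. H n x \<partial>M) - (\<integral>x. h x \<partial>M)) \<le> B * (\<integral>x. e n x \<partial>M)"
  proof (intro always_eventually allI)
    fix n
    have "norm ((\<integral>x. H n x \<partial>M) - (\<integral>x. h x \<partial>M)) = norm (\<integral>x. H n x - h x \<partial>M)"
      using int by simp
    also have "\<dots> \<le> (\<integral>x. norm (H n x - h x) \<partial>M)"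
      by (rule integral_norm_bound)
    also have "\<dots> \<le> (\<integral>x. B * e n x \<partial>M)"
      using int e le by (intro integral_mono) auto
    finally show "norm ((\<integral>x. H n x \<partial>M) - (\<integral>x. h x \<partial>M)) \<le> B * (\<integral>x. e n x \<partial>M)"
      by simp
  qed
  show "(\<lambda>n. B * (\<integral>x. e n x \<partial>M)) \<longlonglongrightarrow> 0"
    using tendsto_mult_right_zero[OF lim] .
qed

text \<open>The defining identity is stable under convergence in \<open>L\<^sup>1\<close>, because test functions and their
  gradients are bounded.\<close>

lemma has_weak_gradient_limit:
  fixes f :: "'n::finite torus \<Rightarrow> real"
  assumes ints: "\<And>n. integrable torus_measure (F n)" "integrable torus_measure f"
      "\<And>n. integrable torus_measure (G n)" "integrable torus_measure g"
    and F: "(\<lambda>n. \<integral>x. norm (F n x - f x) \<partial>torus_measure) \<longlonglongrightarrow> 0"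
    and G: "(\<lambda>n. \<integral>x. norm (G n x - g x) \<partial>torus_measure) \<longlonglongrightarrow> 0"
    and wg: "\<And>n. has_weak_gradient (F n) (G n)"
  shows "has_weak_gradient f g"
  unfolding has_weak_gradient_def
proof (intro allI impI)
  fix \<phi> :: "'n torus \<Rightarrow> real" assume \<phi>: "smooth (\<phi> \<circ> torus_proj)"
  obtain B where B: "\<And>x. norm (torus_gradient \<phi> x) \<le> B"
    using torus_gradient_bounded_measurable[OF \<phi>] by blast
  obtain C where C: "\<And>x. norm (\<phi> x) \<le> C"
    using bounded_lift[OF smooth_imp_continuous[OF \<phi>]] by blast
  have 1: "(\<lambda>n. \<integral>x. F n x *\<^sub>R torus_gradient \<phi> x \<partial>torus_measure)
      \<longlonglongrightarrow> (\<integral>x. f x *\<^sub>R torus_gradient \<phi> x \<partial>torus_measure)"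
  proof (rule integral_bounded_times_tendsto[OF _ _ _ _ F])
    show "norm (F n x *\<^sub>R torus_gradient \<phi> x - f x *\<^sub>R torus_gradient \<phi> x) \<le> B * norm (F n x - f x)" for n x
      using mult_right_mono[OF B[of x] norm_ge_zero[of "F n x - f x"]]
      by (simp add: mult.commute flip: scaleR_left_diff_distrib)
  qed (use ints \<phi> in \<open>auto intro: integrable_scaleR_torus_gradient\<close>)
  have 2: "(\<lambda>n. \<integral>x. \<phi> x *\<^sub>R G n x \<partial>torus_measure) \<longlonglongrightarrow> (\<integral>x. \<phi> x *\<^sub>R g x \<partial>torus_measure)"
  proof (rule integral_bounded_times_tendsto[OF _ _ _ _ G])
    show "norm (\<phi> x *\<^sub>R G n x - \<phi> x *\<^sub>R g x) \<le> C * norm (G n x - g x)" for n x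
      using C[of x] by (simp add: mult_right_mono flip: scaleR_right_diff_distrib)
  qed (use ints \<phi> in \<open>auto intro: integrable_smooth_scaleR\<close>)
  have 3: "(\<integral>x. F n x *\<^sub>R torus_gradient \<phi> x \<partial>torus_measure)
      = - (\<integral>x. \<phi> x *\<^sub>R G n x \<partial>torus_measure)" for n
    using wg[of n] \<phi> unfolding has_weak_gradient_def by blast
  show "(\<integral>x. f x *\<^sub>R torus_gradient \<phi> x \<partial>torus_measure)
      = - (\<integral>x. \<phi> x *\<^sub>R g x \<partial>torus_measure)"
    by (rule LIMSEQ_unique[OF 1[unfolded 3] tendsto_minus[OF 2]])
qed

text \<open>Keeping the gradient as explicit data allows linear combinations and limits to be formed before
  the choice in \<open>weak_gradient\<close> is compared with them.\<close>

definition sobolev_pair :: "('n::finite torus \<Rightarrow> real) \<Rightarrow> ('n torus \<Rightarrow> real ^ 'n) \<Rightarrow> bool"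
  where "sobolev_pair f g \<longleftrightarrow> square_integrable torus_measure f \<and> square_integrable torus_measure g
    \<and> has_weak_gradient f g \<and> (\<integral>x. f x \<partial>torus_measure) = 0"

lemma sobolev_pair_weak_gradient:
  assumes "f \<in> H1_mean_zero"
  shows "sobolev_pair f (weak_gradient f)"
proof -
  have "\<exists>g. square_integrable torus_measure g \<and> has_weak_gradient f g"
    using assms by (simp add: H1_mean_zero_def H1_def)
  from someI_ex[OF this] show ?thesis
    using assms by (simp add: sobolev_pair_def H1_mean_zero_def H1_def weak_gradient_def)
qed

lemma sobolev_pair_integrable:
  assumes "sobolev_pair f g"
  shows "integrable torus_measure f" "integrable torus_measure g"
proof -
  interpret prob_space "torus_measure :: 'a torus measure" by (rule prob_space_torus_measure)
  show "integrable torus_measure f" "integrable torus_measure g"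
    using assms square_integrable_imp_integrable unfolding sobolev_pair_def by blast+
qed

lemma sobolev_pair_H1:
  assumes "sobolev_pair f g"
  shows "f \<in> H1_mean_zero" "AE x in torus_measure. weak_gradient f x = g x"
proof -
  show f: "f \<in> H1_mean_zero"
    using assms by (auto simp: sobolev_pair_def H1_mean_zero_def H1_def)
  note f' = sobolev_pair_weak_gradient[OF f]
  show "AE x in torus_measure. weak_gradient f x = g x"
    using has_weak_gradient_unique[OF sobolev_pair_integrable(1)[OF assms]
        sobolev_pair_integrable(2)[OF f'] _ sobolev_pair_integrable(2)[OF assms]] assms f'
    by (simp add: sobolev_pair_def)
qed

lemma sobolev_pair_combine:
  assumes "sobolev_pair f g" "sobolev_pair f' g'"
  shows "sobolev_pair (\<lambda>x. a * f x + b * f' x) (\<lambda>x. a *\<^sub>R g x + b *\<^sub>R g' x)"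
proof -
  note i = sobolev_pair_integrable[OF assms(1)] sobolev_pair_integrable[OF assms(2)]
  have "has_weak_gradient (\<lambda>x. a * f x + b * f' x) (\<lambda>x. a *\<^sub>R g x + b *\<^sub>R g' x)"
    using i assms by (intro has_weak_gradient_linear_combination) (auto simp: sobolev_pair_def)
  moreover have sq: "square_integrable torus_measure f" "square_integrable torus_measure f'"
    "square_integrable torus_measure g" "square_integrable torus_measure g'"
    using assms by (auto simp: sobolev_pair_def)
  have "square_integrable torus_measure (\<lambda>x. a *\<^sub>R f x + b *\<^sub>R f' x)"
    "square_integrable torus_measure (\<lambda>x. a *\<^sub>R g x + b *\<^sub>R g' x)"
    by (intro square_integrable_add square_integrable_scaleR sq)+
  ultimately show ?thesis
    using i assms by (simp add: sobolev_pair_def)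
qed

lemma sobolev_pair_diff:
  assumes "sobolev_pair f g" "sobolev_pair f' g'"
  shows "sobolev_pair (\<lambda>x. f x - f' x) (\<lambda>x. g x - g' x)"
  using sobolev_pair_combine[OF assms, of 1 "- 1"] by simp

lemma sobolev_pair_Poincare:
  fixes f :: "'n::finite torus \<Rightarrow> real"
  assumes "sobolev_pair f g"
  shows "(\<integral>x. (norm (f x))\<^sup>2 \<partial>torus_measure)
    \<le> (real CARD('n))\<^sup>2 * (\<integral>x. (norm (g x))\<^sup>2 \<partial>torus_measure)"
  using assms torus_Poincare unfolding sobolev_pair_def by blast

text \<open>By the Poincare inequality, convergence of the gradients forces convergence of the functions.\<close>

lemma sobolev_pair_complete:
  fixes F :: "nat \<Rightarrow> 'n::finite torus \<Rightarrow> real"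
  assumes FG: "\<And>n. sobolev_pair (F n) (G n)"
    and Cauchy: "\<And>e. e > 0 \<Longrightarrow>
      \<exists>N. \<forall>m\<ge>N. \<forall>n\<ge>N. (\<integral>x. (norm (G m x - G n x))\<^sup>2 \<partial>torus_measure) < e"
  obtains f g where "sobolev_pair f g"
    and "(\<lambda>n. \<integral>x. (norm (G n x - g x))\<^sup>2 \<partial>torus_measure) \<longlonglongrightarrow> 0"
proof -
  interpret prob_space "torus_measure :: 'n torus measure" by (rule prob_space_torus_measure)
  have sq: "square_integrable torus_measure (F n)" "square_integrable torus_measure (G n)" for n
    using FG by (auto simp: sobolev_pair_def)
  obtain g where g: "square_integrable torus_measure g"
    and Gg: "(\<lambda>n. \<integral>x. (norm (G n x - g x))\<^sup>2 \<partial>torus_measure) \<longlonglongrightarrow> 0"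
    using square_integrable_complete[OF sq(2) Cauchy] by blast
  have "\<exists>N. \<forall>m\<ge>N. \<forall>n\<ge>N. (\<integral>x. (norm (F m x - F n x))\<^sup>2 \<partial>torus_measure) < e" if "e > 0" for e
  proof -
    have pos: "0 < (real CARD('n))\<^sup>2" by simp
    then obtain N where N: "\<And>m n. m \<ge> N \<Longrightarrow> n \<ge> N \<Longrightarrow>
        (\<integral>x. (norm (G m x - G n x))\<^sup>2 \<partial>torus_measure) < e / (real CARD('n))\<^sup>2"
      using Cauchy[of "e / (real CARD('n))\<^sup>2"] \<open>e > 0\<close> by auto
    have "(\<integral>x. (norm (F m x - F n x))\<^sup>2 \<partial>torus_measure) < e" if "m \<ge> N" "n \<ge> N" for m n
    proof -
      have "(\<integral>x. (norm (F m x - F n x))\<^sup>2 \<partial>torus_measure)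
          \<le> (real CARD('n))\<^sup>2 * (\<integral>x. (norm (G m x - G n x))\<^sup>2 \<partial>torus_measure)"
        by (rule sobolev_pair_Poincare[OF sobolev_pair_diff[OF FG FG]])
      also have "\<dots> < e"
        using N[OF that] pos by (simp add: pos_less_divide_eq mult.commute)
      finally show ?thesis .
    qed
    then show ?thesis by blast
  qed
  from square_integrable_complete[OF sq(1) this]
  obtain f where f: "square_integrable torus_measure f"
    and Ff: "(\<lambda>n. \<integral>x. (norm (F n x - f x))\<^sup>2 \<partial>torus_measure) \<longlonglongrightarrow> 0"
    by blast
  note Ff1 = L2_limit_imp_L1_limit[OF sq(1) f Ff]
  note Gg1 = L2_limit_imp_L1_limit[OF sq(2) g Gg]
  note ints = sq[THEN square_integrable_imp_integrable] f[THEN square_integrable_imp_integrable]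
    g[THEN square_integrable_imp_integrable]
  have "has_weak_gradient f g"
    by (rule has_weak_gradient_limit[OF _ _ _ _ Ff1 Gg1])
       (use ints FG in \<open>auto simp: sobolev_pair_def\<close>)
  moreover have "(\<lambda>n. \<integral>x. F n x \<partial>torus_measure) \<longlonglongrightarrow> (\<integral>x. f x \<partial>torus_measure)"
    by (rule integral_bounded_times_tendsto[OF _ _ _ _ Ff1, where B = 1]) (use ints in auto)
  then have "(\<integral>x. f x \<partial>torus_measure) = 0"
    using FG by (simp add: sobolev_pair_def LIMSEQ_const_iff)
  ultimately have "sobolev_pair f g"
    using f g by (simp add: sobolev_pair_def)
  with Gg that show ?thesis by blast
qed

section \<open>Quadratic functionals and their minimizers\<close>

text \<open>The direct method for a uniformly convex functional. Here \<open>d\<close> plays the role of a squared distance: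
  the midpoint condition makes minimizing sequences Cauchy, and the perturbation condition, used with \<open>\<epsilon>\<close>
  tending to \<open>0\<close> after passing to the limit along the sequence, is lower semicontinuity.\<close>

lemma quadratic_minimizer_exists:
  fixes Q :: "'a \<Rightarrow> real" and d :: "'a \<Rightarrow> 'a \<Rightarrow> real"
  assumes "X \<noteq> {}" and "c > 0"
    and nonneg: "\<And>x. x \<in> X \<Longrightarrow> 0 \<le> Q x"
    and midpoint: "\<And>x y. x \<in> X \<Longrightarrow> y \<in> X \<Longrightarrow> \<exists>z\<in>X. Q z \<le> (Q x + Q y) / 2 - c * d x y"
    and complete: "\<And>s. (\<And>n::nat. s n \<in> X) \<Longrightarrow>
      (\<And>e. e > 0 \<Longrightarrow> \<exists>N. \<forall>m\<ge>N. \<forall>n\<ge>N. d (s m) (s n) < e) \<Longrightarrow> \<exists>x\<in>X. (\<lambda>n. d (s n) x) \<longlonglongrightarrow> 0"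
    and continuous: "\<And>x y \<epsilon>. x \<in> X \<Longrightarrow> y \<in> X \<Longrightarrow> \<epsilon> > 0 \<Longrightarrow>
      Q x \<le> (1 + \<epsilon>) * Q y + (1 + 1 / \<epsilon>) * C * d y x"
  shows "\<exists>x\<in>X. \<forall>y\<in>X. Q x \<le> Q y"
proof -
  define I where "I = Inf (Q ` X)"
  have bdd: "bdd_below (Q ` X)"
    using nonneg by (auto intro!: bdd_belowI2)
  have I_le: "I \<le> Q y" if "y \<in> X" for y
    unfolding I_def using that bdd by (auto intro: cInf_lower)
  have I_nonneg: "0 \<le> I"
    unfolding I_def using \<open>X \<noteq> {}\<close> nonneg by (auto intro: cInf_greatest)
  have "\<exists>x\<in>X. Q x < I + inverse (real (Suc n))" for n
  proof -
    have "I < I + inverse (real (Suc n))" by simp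
    then show ?thesis
      unfolding I_def using \<open>X \<noteq> {}\<close> bdd by (subst (asm) cInf_less_iff) auto
  qed
  then obtain s where sX: "\<And>n. s n \<in> X" and s: "\<And>n. Q (s n) < I + inverse (real (Suc n))"
    by metis
  have Q_lim: "(\<lambda>n. Q (s n)) \<longlonglongrightarrow> I"
  proof (rule tendsto_sandwich)
    show "\<forall>\<^sub>F n in sequentially. I \<le> Q (s n)"
      using I_le sX by simp
    show "\<forall>\<^sub>F n in sequentially. Q (s n) \<le> I + inverse (real (Suc n))"
      using s by (simp add: less_imp_le)
    show "(\<lambda>n. I + inverse (real (Suc n))) \<longlonglongrightarrow> I"
      using tendsto_add[OF tendsto_const LIMSEQ_inverse_real_of_nat, of I] by simp
  qed simp
  have "\<exists>N. \<forall>m\<ge>N. \<forall>n\<ge>N. d (s m) (s n) < e" if "e > 0" for e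
  proof -
    obtain N where N: "inverse (real (Suc N)) < c * e"
      using reals_Archimedean[of "c * e"] \<open>c > 0\<close> \<open>e > 0\<close> by auto
    have "d (s m) (s n) < e" if "m \<ge> N" "n \<ge> N" for m n
    proof -
      obtain z where "z \<in> X" and z: "Q z \<le> (Q (s m) + Q (s n)) / 2 - c * d (s m) (s n)"
        using midpoint[OF sX sX] by blast
      have le: "inverse (real (Suc k)) \<le> inverse (real (Suc N))" if "k \<ge> N" for k
        using that by (intro le_imp_inverse_le) auto
      have "c * d (s m) (s n) < c * e"
        using I_le[OF \<open>z \<in> X\<close>] z s[of m] s[of n] N le[OF \<open>m \<ge> N\<close>] le[OF \<open>n \<ge> N\<close>] by argo
      then show ?thesis
        using \<open>c > 0\<close> by simp
    qed
    then show ?thesis by blast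
  qed
  from complete[OF sX this] obtain x where "x \<in> X" and x: "(\<lambda>n. d (s n) x) \<longlonglongrightarrow> 0"
    by blast
  have "Q x \<le> I"
  proof (rule field_le_epsilon)
    fix e :: real assume "e > 0"
    \<comment> \<open>The error left after passing to the limit is \<open>\<epsilon> * I\<close>, and \<open>I\<close> may be \<open>0\<close>.\<close>
    define \<epsilon> where "\<epsilon> = e / (I + 1)"
    have "\<epsilon> > 0" using \<open>e > 0\<close> I_nonneg by (simp add: \<epsilon>_def)
    have "(\<lambda>n. (1 + \<epsilon>) * Q (s n) + (1 + 1 / \<epsilon>) * C * d (s n) x)
        \<longlonglongrightarrow> (1 + \<epsilon>) * I + (1 + 1 / \<epsilon>) * C * 0"
      by (intro tendsto_intros Q_lim x)
    then have "Q x \<le> (1 + \<epsilon>) * I + (1 + 1 / \<epsilon>) * C * 0"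
      by (rule LIMSEQ_le_const) (use continuous[OF \<open>x \<in> X\<close> sX \<open>\<epsilon> > 0\<close>] in auto)
    moreover have "\<epsilon> * I \<le> e"
      using \<open>e > 0\<close> I_nonneg by (simp add: \<epsilon>_def field_simps)
    ultimately show "Q x \<le> I + e"
      by (simp add: distrib_right)
  qed
  then show ?thesis
    using \<open>x \<in> X\<close> I_le by (blast intro: order_trans)
qed

lemma power2_norm_midpoint:
  fixes a b c :: "'b::real_inner"
  shows "(norm (a - (b + c) /\<^sub>R 2))\<^sup>2
    = ((norm (a - b))\<^sup>2 + (norm (a - c))\<^sup>2) / 2 - (norm (b - c))\<^sup>2 / 4"
proof -
  have "4 * (norm (a - (b + c) /\<^sub>R 2))\<^sup>2 = (norm (2 *\<^sub>R (a - (b + c) /\<^sub>R 2)))\<^sup>2"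
    by (simp add: power_mult_distrib)
  also have "2 *\<^sub>R (a - (b + c) /\<^sub>R 2) = (a - b) + (a - c)"
    by (simp add: scaleR_right_diff_distrib scaleR_2)
  also have "(norm ((a - b) + (a - c)))\<^sup>2
      = 2 * (norm (a - b))\<^sup>2 + 2 * (norm (a - c))\<^sup>2 - (norm (b - c))\<^sup>2"
    by (simp add: power2_norm_eq_inner algebra_simps inner_commute)
  finally show ?thesis by argo
qed

text \<open>Expand the square of \<open>\<epsilon> a - b\<close>, divided by \<open>\<epsilon>\<close>.\<close>

lemma power2_norm_add_le_weighted:
  fixes a b :: "'b::real_inner"
  assumes "\<epsilon> > 0"
  shows "(norm (a + b))\<^sup>2 \<le> (1 + \<epsilon>) * (norm a)\<^sup>2 + (1 + 1 / \<epsilon>) * (norm b)\<^sup>2"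
proof -
  have "0 \<le> (norm (\<epsilon> *\<^sub>R a - b))\<^sup>2 / \<epsilon>"
    using assms by simp
  also have "\<dots> = \<epsilon> * (norm a)\<^sup>2 + (norm b)\<^sup>2 / \<epsilon> - 2 * (a \<bullet> b)"
    using assms by (simp add: power2_norm_eq_inner inner_diff inner_commute field_simps)
  finally show ?thesis
    by (simp add: power2_norm_eq_inner inner_add inner_commute algebra_simps)
qed

lemma (in prob_space) distr_pair_snd:
  assumes "sigma_finite_measure N"
  shows "distr (M \<Otimes>\<^sub>M N) N snd = N"
proof (rule measure_eqI)
  interpret N: sigma_finite_measure N by fact
  fix A assume "A \<in> sets (distr (M \<Otimes>\<^sub>M N) N snd)"
  then have A: "A \<in> sets N" by simp
  have "snd -` A \<inter> space (M \<Otimes>\<^sub>M N) = space M \<times> A"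
    using sets.sets_into_space[OF A] by (auto simp: space_pair_measure)
  then show "emeasure (distr (M \<Otimes>\<^sub>M N) N snd) A = emeasure N A"
    using A by (simp add: emeasure_distr N.emeasure_pair_measure_Times emeasure_space_1)
qed simp

text \<open>The functional as a function of the gradient field alone. Positivity of the kernel and of the
  regularisation parameter enter together, through the single constant \<open>k0 + lam\<close>.\<close>

locale quadratic_cost =
  P: prob_space P + M: prob_space M
  for P :: "'a measure" and M :: "'c measure" +
  fixes W :: "'a \<Rightarrow> 'b::euclidean_space" and k :: "'a \<times> 'c \<Rightarrow> real"
    and lam k0 k1 W1 :: real
  assumes W_measurable [measurable]: "W \<in> borel_measurable P"
    and W_bounded: "\<And>a. norm (W a) \<le> W1"
    and k_measurable [measurable]: "k \<in> borel_measurable (P \<Otimes>\<^sub>M M)"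
    and k_bounds: "\<And>p. k0 \<le> k p" "\<And>p. k p \<le> k1"
    and k0_nonneg: "0 \<le> k0" and lam_nonneg: "0 \<le> lam" and coercive: "0 < k0 + lam"
begin

sublocale N: prob_space "P \<Otimes>\<^sub>M M"
  by (intro prob_space_pair P.prob_space_axioms M.prob_space_axioms)

definition cost :: "('c \<Rightarrow> 'b) \<Rightarrow> real"
  where "cost g = (\<integral>p. (norm (W (fst p) - g (snd p)))\<^sup>2 * k p \<partial>(P \<Otimes>\<^sub>M M))
    + lam * (\<integral>z. (norm (g z))\<^sup>2 \<partial>M)"

lemma k_nonneg: "0 \<le> k p"
  using k0_nonneg k_bounds(1) order_trans by blast

lemma snd_integral:
  fixes w :: "'c \<Rightarrow> real"
  assumes "integrable M w"
  shows "integrable (P \<Otimes>\<^sub>M M) (\<lambda>p. w (snd p))"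
    and "(\<integral>p. w (snd p) \<partial>(P \<Otimes>\<^sub>M M)) = (\<integral>z. w z \<partial>M)"
proof -
  have D: "distr (P \<Otimes>\<^sub>M M) M snd = M"
    by (rule P.distr_pair_snd) (rule M.sigma_finite_measure_axioms)
  have wm: "w \<in> borel_measurable M"
    using assms by simp
  show "integrable (P \<Otimes>\<^sub>M M) (\<lambda>p. w (snd p))"
    using assms unfolding integrable_distr_eq[OF measurable_snd wm, symmetric] D .
  show "(\<integral>p. w (snd p) \<partial>(P \<Otimes>\<^sub>M M)) = (\<integral>z. w z \<partial>M)"
    unfolding integral_distr[OF measurable_snd wm, symmetric] D ..
qed

lemma integrable_weighted:
  assumes [measurable]: "v \<in> borel_measurable (P \<Otimes>\<^sub>M M)"
    and "integrable (P \<Otimes>\<^sub>M M) w" and "\<And>p. 0 \<le> v p" "\<And>p. v p \<le> w p"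
  shows "integrable (P \<Otimes>\<^sub>M M) (\<lambda>p. v p * k p)"
proof (rule Bochner_Integration.integrable_bound)
  show "integrable (P \<Otimes>\<^sub>M M) (\<lambda>p. w p * k1)"
    using assms by simp
  have "v p * k p \<le> w p * k1" for p
    using assms(3,4)[of p] k_nonneg[of p] k_bounds(2)[of p] by (intro mult_mono) auto
  then have "v p * k p \<le> \<bar>w p * k1\<bar>" for p
    using abs_ge_self order_trans by blast
  then show "AE p in P \<Otimes>\<^sub>M M. norm (v p * k p) \<le> norm (w p * k1)"
    using assms(3) k_nonneg by simp
qed measurable

lemma integrable_cost:
  assumes "square_integrable M g"
  shows "integrable (P \<Otimes>\<^sub>M M) (\<lambda>p. (norm (W (fst p) - g (snd p)))\<^sup>2 * k p)"
proof (rule integrable_weighted)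
  note [measurable] = square_integrable_measurable[OF assms]
  show "(\<lambda>p. (norm (W (fst p) - g (snd p)))\<^sup>2) \<in> borel_measurable (P \<Otimes>\<^sub>M M)"
    by measurable
  show "integrable (P \<Otimes>\<^sub>M M) (\<lambda>p. 2 * W1\<^sup>2 + 2 * (norm (g (snd p)))\<^sup>2)"
    using snd_integral(1)[OF square_integrableD[OF assms]] by simp
  show "(norm (W (fst p) - g (snd p)))\<^sup>2 \<le> 2 * W1\<^sup>2 + 2 * (norm (g (snd p)))\<^sup>2" for p
  proof -
    have "(norm (W (fst p)))\<^sup>2 \<le> W1\<^sup>2"
      by (intro power_mono W_bounded) simp
    then show ?thesis
      using power2_norm_add_le[of "W (fst p)" "- g (snd p)"] by simp
  qed
qed simp

lemma integrable_weighted_norm: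
  assumes "square_integrable M g"
  shows "integrable (P \<Otimes>\<^sub>M M) (\<lambda>p. (norm (g (snd p)))\<^sup>2 * k p)"
proof (rule integrable_weighted[OF _ snd_integral(1)[OF square_integrableD[OF assms]]])
  note [measurable] = square_integrable_measurable[OF assms]
  show "(\<lambda>p. (norm (g (snd p)))\<^sup>2) \<in> borel_measurable (P \<Otimes>\<^sub>M M)"
    by measurable
qed auto

lemma weighted_norm_bounds:
  assumes g: "square_integrable M g"
  shows "k0 * (\<integral>z. (norm (g z))\<^sup>2 \<partial>M) \<le> (\<integral>p. (norm (g (snd p)))\<^sup>2 * k p \<partial>(P \<Otimes>\<^sub>M M))"
    and "(\<integral>p. (norm (g (snd p)))\<^sup>2 * k p \<partial>(P \<Otimes>\<^sub>M M)) \<le> k1 * (\<integral>z. (norm (g z))\<^sup>2 \<partial>M)"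
proof -
  note i = snd_integral[OF square_integrableD[OF g]]
  have "(\<integral>p. (norm (g (snd p)))\<^sup>2 * k0 \<partial>(P \<Otimes>\<^sub>M M)) \<le> (\<integral>p. (norm (g (snd p)))\<^sup>2 * k p \<partial>(P \<Otimes>\<^sub>M M))"
    using i k_bounds(1) by (intro integral_mono integrable_weighted_norm g mult_left_mono) auto
  then show "k0 * (\<integral>z. (norm (g z))\<^sup>2 \<partial>M) \<le> (\<integral>p. (norm (g (snd p)))\<^sup>2 * k p \<partial>(P \<Otimes>\<^sub>M M))"
    by (simp add: i(2) mult.commute)
  have "(\<integral>p. (norm (g (snd p)))\<^sup>2 * k p \<partial>(P \<Otimes>\<^sub>M M)) \<le> (\<integral>p. (norm (g (snd p)))\<^sup>2 * k1 \<partial>(P \<Otimes>\<^sub>M M))"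
    using i k_bounds(2) by (intro integral_mono integrable_weighted_norm g mult_left_mono) auto
  then show "(\<integral>p. (norm (g (snd p)))\<^sup>2 * k p \<partial>(P \<Otimes>\<^sub>M M)) \<le> k1 * (\<integral>z. (norm (g z))\<^sup>2 \<partial>M)"
    by (simp add: i(2) mult.commute)
qed

lemma cost_nonneg: "0 \<le> cost g"
  unfolding cost_def using k_nonneg lam_nonneg
  by (intro add_nonneg_nonneg mult_nonneg_nonneg integral_nonneg_AE) auto

text \<open>The parallelogram identity holds pointwise under both integrals; the bound \<open>k0 \<le> k\<close> turns the
  weighted defect into the squared distance in \<open>L\<^sup>2\<close>.\<close>

lemma cost_midpoint:
  assumes g: "square_integrable M g" and h: "square_integrable M h"
  shows "cost (\<lambda>z. (g z + h z) /\<^sub>R 2)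
    \<le> (cost g + cost h) / 2 - (k0 + lam) / 4 * (\<integral>z. (norm (g z - h z))\<^sup>2 \<partial>M)"
proof -
  have gh: "square_integrable M (\<lambda>z. g z - h z)"
    by (rule square_integrable_diff[OF g h])
  let ?c = "\<lambda>g p. (norm (W (fst p) - g (snd p)))\<^sup>2 * k p"
  let ?d = "\<lambda>p. (norm (g (snd p) - h (snd p)))\<^sup>2 * k p"
  note i = integrable_cost[OF g] integrable_cost[OF h] integrable_weighted_norm[OF gh]
  have "?c (\<lambda>z. (g z + h z) /\<^sub>R 2) p = (?c g p + ?c h p) / 2 - ?d p / 4" for p
    by (simp only: power2_norm_midpoint) (simp add: field_simps)
  then have 1: "(\<integral>p. ?c (\<lambda>z. (g z + h z) /\<^sub>R 2) p \<partial>(P \<Otimes>\<^sub>M M))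
      = ((\<integral>p. ?c g p \<partial>(P \<Otimes>\<^sub>M M)) + (\<integral>p. ?c h p \<partial>(P \<Otimes>\<^sub>M M))) / 2 - (\<integral>p. ?d p \<partial>(P \<Otimes>\<^sub>M M)) / 4"
    using i by simp
  note j = square_integrableD[OF g] square_integrableD[OF h] square_integrableD[OF gh]
  have "(norm ((g z + h z) /\<^sub>R 2))\<^sup>2 = ((norm (g z))\<^sup>2 + (norm (h z))\<^sup>2) / 2 - (norm (g z - h z))\<^sup>2 / 4" for z
    using power2_norm_midpoint[of 0 "g z" "h z"] by simp
  then have 2: "(\<integral>z. (norm ((g z + h z) /\<^sub>R 2))\<^sup>2 \<partial>M)
      = ((\<integral>z. (norm (g z))\<^sup>2 \<partial>M) + (\<integral>z. (norm (h z))\<^sup>2 \<partial>M)) / 2 - (\<integral>z. (norm (g z - h z))\<^sup>2 \<partial>M) / 4"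
    using j by simp
  show ?thesis
    unfolding cost_def 1 2 using weighted_norm_bounds(1)[OF gh] by (simp add: field_simps)
qed

lemma cost_perturbation:
  assumes g: "square_integrable M g" and h: "square_integrable M h" and "\<epsilon> > 0"
  shows "cost g \<le> (1 + \<epsilon>) * cost h + (1 + 1 / \<epsilon>) * (k1 + lam) * (\<integral>z. (norm (h z - g z))\<^sup>2 \<partial>M)"
proof -
  have hg: "square_integrable M (\<lambda>z. h z - g z)"
    by (rule square_integrable_diff[OF h g])
  let ?c = "\<lambda>g p. (norm (W (fst p) - g (snd p)))\<^sup>2 * k p"
  let ?d = "\<lambda>p. (norm (h (snd p) - g (snd p)))\<^sup>2 * k p"
  note i = integrable_cost[OF g] integrable_cost[OF h] integrable_weighted_norm[OF hg]
  have "?c g p \<le> (1 + \<epsilon>) * ?c h p + (1 + 1 / \<epsilon>) * ?d p" for p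
  proof -
    have "(norm (W (fst p) - g (snd p)))\<^sup>2 * k p
        \<le> ((1 + \<epsilon>) * (norm (W (fst p) - h (snd p)))\<^sup>2 + (1 + 1 / \<epsilon>) * (norm (h (snd p) - g (snd p)))\<^sup>2) * k p"
      using power2_norm_add_le_weighted[OF \<open>\<epsilon> > 0\<close>, of "W (fst p) - h (snd p)" "h (snd p) - g (snd p)"]
      by (intro mult_right_mono k_nonneg) simp
    then show ?thesis by (simp add: algebra_simps)
  qed
  then have "(\<integral>p. ?c g p \<partial>(P \<Otimes>\<^sub>M M)) \<le> (\<integral>p. (1 + \<epsilon>) * ?c h p + (1 + 1 / \<epsilon>) * ?d p \<partial>(P \<Otimes>\<^sub>M M))"
    using i by (intro integral_mono) auto
  also have "\<dots> = (1 + \<epsilon>) * (\<integral>p. ?c h p \<partial>(P \<Otimes>\<^sub>M M)) + (1 + 1 / \<epsilon>) * (\<integral>p. ?d p \<partial>(P \<Otimes>\<^sub>M M))"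
    using i by simp
  also have "\<dots> \<le> (1 + \<epsilon>) * (\<integral>p. ?c h p \<partial>(P \<Otimes>\<^sub>M M))
      + (1 + 1 / \<epsilon>) * (k1 * (\<integral>z. (norm (h z - g z))\<^sup>2 \<partial>M))"
    using \<open>\<epsilon> > 0\<close> by (intro add_left_mono mult_left_mono weighted_norm_bounds(2)[OF hg]) simp
  finally have 1: "(\<integral>p. ?c g p \<partial>(P \<Otimes>\<^sub>M M)) \<le> \<dots>" .
  note j = square_integrableD[OF g] square_integrableD[OF h] square_integrableD[OF hg]
  have "(norm (g z))\<^sup>2 \<le> (1 + \<epsilon>) * (norm (h z))\<^sup>2 + (1 + 1 / \<epsilon>) * (norm (h z - g z))\<^sup>2" for z
    using power2_norm_add_le_weighted[OF \<open>\<epsilon> > 0\<close>, of "h z" "g z - h z"]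
    by (simp add: norm_minus_commute)
  then have "(\<integral>z. (norm (g z))\<^sup>2 \<partial>M)
      \<le> (\<integral>z. (1 + \<epsilon>) * (norm (h z))\<^sup>2 + (1 + 1 / \<epsilon>) * (norm (h z - g z))\<^sup>2 \<partial>M)"
    using j by (intro integral_mono) auto
  also have "\<dots> = (1 + \<epsilon>) * (\<integral>z. (norm (h z))\<^sup>2 \<partial>M)
      + (1 + 1 / \<epsilon>) * (\<integral>z. (norm (h z - g z))\<^sup>2 \<partial>M)"
    using j by simp
  finally have "lam * (\<integral>z. (norm (g z))\<^sup>2 \<partial>M) \<le> lam * \<dots>"
    using lam_nonneg by (rule mult_left_mono)
  note sum = add_mono[OF 1 this]
  have "a * A + b * (k1 * D) + lam * (a * H + b * D) = a * (A + lam * H) + b * (k1 + lam) * D"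
    for a b A D H :: real
    by (simp add: algebra_simps)
  from sum[unfolded this] show ?thesis
    unfolding cost_def .
qed

lemma cost_cong_AE:
  assumes "square_integrable M g" "square_integrable M h" and eq: "AE z in M. g z = h z"
  shows "cost g = cost h"
proof -
  have [measurable]: "g \<in> borel_measurable M" "h \<in> borel_measurable M"
    using assms by (auto simp: square_integrable_def)
  have D: "distr (P \<Otimes>\<^sub>M M) M snd = M"
    by (rule P.distr_pair_snd) (rule M.sigma_finite_measure_axioms)
  have "AE p in P \<Otimes>\<^sub>M M. g (snd p) = h (snd p)"
    by (rule AE_distrD[OF measurable_snd], unfold D) (rule eq)
  then have "(\<integral>p. (norm (W (fst p) - g (snd p)))\<^sup>2 * k p \<partial>(P \<Otimes>\<^sub>M M))
      = (\<integral>p. (norm (W (fst p) - h (snd p)))\<^sup>2 * k p \<partial>(P \<Otimes>\<^sub>M M))"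
    by (intro integral_cong_AE) auto
  moreover have "(\<integral>z. (norm (g z))\<^sup>2 \<partial>M) = (\<integral>z. (norm (h z))\<^sup>2 \<partial>M)"
    using eq by (intro integral_cong_AE) auto
  ultimately show ?thesis
    by (simp add: cost_def)
qed

end

text \<open>The cost is strictly convex in the gradient, and the gradient determines a mean-zero
  function up to null sets by the Poincare inequality.\<close>

proposition torus_gradient_minimizer:
  fixes W :: "'a \<Rightarrow> real ^ 'd::finite"
  assumes "quadratic_cost P (torus_measure :: 'd torus measure) W k lam k0 k1 W1"
  defines "J \<equiv> \<lambda>f. quadratic_cost.cost P (torus_measure :: 'd torus measure) W k lam (weak_gradient f)"
  shows "\<exists>f. is_arg_min J (\<lambda>h. h \<in> H1_mean_zero) f \<and>
    (\<forall>g. is_arg_min J (\<lambda>h. h \<in> H1_mean_zero) g \<longrightarrow> (AE z in torus_measure. g z = f z))"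
proof -
  let ?T = "torus_measure :: 'd torus measure"
  interpret quadratic_cost P ?T W k lam k0 k1 W1 by fact
  define d where "d f h = (\<integral>z. (norm (weak_gradient f z - weak_gradient h z))\<^sup>2 \<partial>?T)"
    for f h :: "'d torus \<Rightarrow> real"
  have sq: "square_integrable ?T (weak_gradient f)" if "f \<in> H1_mean_zero" for f
    using sobolev_pair_weak_gradient[OF that] by (simp add: sobolev_pair_def)
  have J_eq: "J f = cost g" if "sobolev_pair f g" for f g
  proof -
    have "square_integrable ?T g" using that by (simp add: sobolev_pair_def)
    then show ?thesis
      unfolding J_def
      using sobolev_pair_H1[OF that] by (intro cost_cong_AE sq) auto
  qed
  have midpoint: "\<exists>z\<in>H1_mean_zero. J z \<le> (J f + J h) / 2 - (k0 + lam) / 4 * d f h"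
    if f: "f \<in> H1_mean_zero" and h: "h \<in> H1_mean_zero" for f h
  proof -
    have z: "sobolev_pair (\<lambda>z. inverse 2 * f z + inverse 2 * h z)
        (\<lambda>z. (weak_gradient f z + weak_gradient h z) /\<^sub>R 2)"
      using sobolev_pair_combine[OF sobolev_pair_weak_gradient[OF f] sobolev_pair_weak_gradient[OF h],
          of "inverse 2" "inverse 2"]
      by (simp only: scaleR_right_distrib)
    have "cost (\<lambda>z. (weak_gradient f z + weak_gradient h z) /\<^sub>R 2)
        \<le> (J f + J h) / 2 - (k0 + lam) / 4 * d f h"
      unfolding J_def d_def by (rule cost_midpoint[OF sq[OF f] sq[OF h]])
    then show ?thesis
      using sobolev_pair_H1(1)[OF z] unfolding J_eq[OF z, symmetric] by (rule rev_bexI[rotated])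
  qed
  have "\<exists>f\<in>H1_mean_zero. \<forall>h\<in>H1_mean_zero. J f \<le> J h"
  proof (rule quadratic_minimizer_exists[where c = "(k0 + lam) / 4" and d = d and C = "k1 + lam"])
    have "sobolev_pair (\<lambda>_. 0) (\<lambda>_. 0)"
      by (simp add: sobolev_pair_def square_integrable_def has_weak_gradient_def)
    then show "H1_mean_zero \<noteq> ({} :: ('d torus \<Rightarrow> real) set)"
      using sobolev_pair_H1(1) by blast
    show "(k0 + lam) / 4 > 0" using coercive by simp
    show "0 \<le> J f" for f unfolding J_def by (rule cost_nonneg)
    show "\<exists>z\<in>H1_mean_zero. J z \<le> (J f + J h) / 2 - (k0 + lam) / 4 * d f h"
      if "f \<in> H1_mean_zero" "h \<in> H1_mean_zero" for f h
      by (rule midpoint[OF that])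
    show "J f \<le> (1 + \<epsilon>) * J h + (1 + 1 / \<epsilon>) * (k1 + lam) * d h f"
      if "f \<in> H1_mean_zero" "h \<in> H1_mean_zero" "\<epsilon> > 0" for f h \<epsilon>
      unfolding J_def d_def by (intro cost_perturbation sq that)
    fix s :: "nat \<Rightarrow> 'd torus \<Rightarrow> real"
    assume s: "\<And>n. s n \<in> H1_mean_zero"
      and Cauchy: "\<And>e. e > 0 \<Longrightarrow> \<exists>N. \<forall>m\<ge>N. \<forall>n\<ge>N. d (s m) (s n) < e"
    obtain f g where fg: "sobolev_pair f g"
      and lim: "(\<lambda>n. \<integral>z. (norm (weak_gradient (s n) z - g z))\<^sup>2 \<partial>?T) \<longlonglongrightarrow> 0"
      using sobolev_pair_complete[OF sobolev_pair_weak_gradient[OF s] Cauchy[unfolded d_def]] by blast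
    have f: "f \<in> H1_mean_zero" by (rule sobolev_pair_H1(1)[OF fg])
    have d_eq: "d (s n) f = (\<integral>z. (norm (weak_gradient (s n) z - g z))\<^sup>2 \<partial>?T)" for n
      unfolding d_def
    proof (rule integral_cong_AE)
      have "square_integrable ?T g" using fg by (simp add: sobolev_pair_def)
      note m = this[THEN square_integrable_measurable]
        sq[OF s, THEN square_integrable_measurable] sq[OF f, THEN square_integrable_measurable]
      show "(\<lambda>z. (norm (weak_gradient (s n) z - weak_gradient f z))\<^sup>2) \<in> borel_measurable ?T"
        and "(\<lambda>z. (norm (weak_gradient (s n) z - g z))\<^sup>2) \<in> borel_measurable ?T"
        using m by measurable
      show "AE z in ?T. (norm (weak_gradient (s n) z - weak_gradient f z))\<^sup>2
          = (norm (weak_gradient (s n) z - g z))\<^sup>2"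
        using sobolev_pair_H1(2)[OF fg] by eventually_elim simp
    qed
    have "(\<lambda>n. d (s n) f) \<longlonglongrightarrow> 0"
      unfolding d_eq by (rule lim)
    with f show "\<exists>f\<in>H1_mean_zero. (\<lambda>n. d (s n) f) \<longlonglongrightarrow> 0"
      by blast
  qed
  then obtain f where f: "f \<in> H1_mean_zero" and min: "\<And>h. h \<in> H1_mean_zero \<Longrightarrow> J f \<le> J h"
    by blast
  have "AE z in ?T. g z = f z" if "is_arg_min J (\<lambda>h. h \<in> H1_mean_zero) g" for g
  proof -
    have g: "g \<in> H1_mean_zero" and Jg: "J g \<le> J f"
      using that f by (auto simp: is_arg_min_linorder)
    obtain z where z: "z \<in> H1_mean_zero" "J z \<le> (J g + J f) / 2 - (k0 + lam) / 4 * d g f"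
      using midpoint[OF g f] by blast
    have "(k0 + lam) / 4 * d g f \<le> 0"
      using z(2) min[OF z(1)] Jg by argo
    then have "d g f \<le> 0"
      using coercive by (simp add: mult_le_0_iff)
    note gf = sobolev_pair_diff[OF sobolev_pair_weak_gradient[OF g] sobolev_pair_weak_gradient[OF f]]
    have sqgf: "square_integrable ?T (\<lambda>z. g z - f z)"
      using gf by (simp add: sobolev_pair_def)
    have "(\<integral>z. (norm (g z - f z))\<^sup>2 \<partial>?T) \<le> (real CARD('d))\<^sup>2 * d g f"
      unfolding d_def by (rule sobolev_pair_Poincare[OF gf])
    also have "\<dots> \<le> 0"
      using \<open>d g f \<le> 0\<close> by (simp add: mult_nonneg_nonpos)
    finally have "(\<integral>z. (norm (g z - f z))\<^sup>2 \<partial>?T) = 0"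
      by (intro antisym integral_nonneg_AE) auto
    then have "AE z in ?T. (norm (g z - f z))\<^sup>2 = 0"
      by (subst (asm) integral_nonneg_eq_0_iff_AE[OF square_integrableD[OF sqgf]]) auto
    then show ?thesis
      by eventually_elim simp
  qed
  then show ?thesis
    using f min by (intro exI[of _ f]) (auto simp: is_arg_min_linorder)
qed

theorem proposition1:
  fixes V :: "'p::finite torus \<times> 'd::finite torus \<Rightarrow> real"
    and K :: "'d torus \<times> 'd torus \<Rightarrow> real"
    and lam :: real
    and \<nu> :: "('p torus \<times> 'd torus) measure"
  assumes "smooth (V \<circ> map_prod torus_proj torus_proj)"
    and "smooth (K \<circ> map_prod torus_proj torus_proj)"
    and "\<And>y z. K (y, z) \<ge> 0"
    and "\<And>y. (\<integral>z. K (y, z) \<partial>torus_measure) = 1"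
    and "\<And>y z. K (y, z) = K (z, y)"
    and "lam \<ge> 0"
    and "(\<forall>y z. K (y, z) > 0) \<or> lam > 0"
    and "prob_space \<nu>" and "sets \<nu> = sets borel"
  shows "\<exists>f. is_arg_min (J_functional V K lam \<nu>) (\<lambda>h. h \<in> H1_mean_zero) f \<and>
    (\<forall>g. is_arg_min (J_functional V K lam \<nu>) (\<lambda>h. h \<in> H1_mean_zero) g \<longrightarrow>
      (AE z in torus_measure. g z = f z))"
proof -
  let ?T = "torus_measure :: 'd torus measure"
  define W where "W = (\<lambda>(q, y). torus_gradient (\<lambda>y'. V (q, y')) y)"
  define k where "k = (\<lambda>((q :: 'p torus, y), z). K (y, z))"
  have cW: "continuous_on UNIV (W \<circ> map_prod torus_proj torus_proj)"
    unfolding W_def by (rule continuous_partial_torus_gradient[OF assms(1)])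
  have cK: "continuous_on UNIV (K \<circ> map_prod torus_proj torus_proj)"
    by (rule smooth_imp_continuous[OF assms(2)])
  obtain W1 where W1: "\<And>a. norm (W a) \<le> W1"
    using compact_imp_bounded[OF compact_range_lift2[OF cW]] by (auto simp: bounded_iff)
  obtain k1 where k1: "\<And>p. K p \<le> k1"
    using compact_imp_bounded[OF compact_range_lift2[OF cK]]
    by (auto simp: bounded_iff intro: order_trans[OF abs_ge_self])
  obtain k0 where k0: "0 \<le> k0" "0 < k0 + lam" "\<And>p. k0 \<le> K p"
  proof (cases "lam > 0")
    case True
    show ?thesis by (rule that[of 0]) (use True assms(3) in auto)
  next
    case False
    obtain p0 where "\<And>p. K p0 \<le> K p"
      using compact_attains_inf[OF compact_range_lift2[OF cK]] by auto
    moreover have "K p0 > 0"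
      using False assms(7) by (cases p0) auto
    ultimately show ?thesis
      using that[of "K p0"] assms(6) by auto
  qed
  have fst_m: "fst \<in> \<nu> \<rightarrow>\<^sub>M borel" and snd_m: "snd \<in> \<nu> \<rightarrow>\<^sub>M borel"
    by (simp_all add: measurable_cong_sets[OF assms(9) refl] borel_measurable_continuous_onI
        continuous_on_fst continuous_on_snd continuous_on_id)
  interpret prob_space \<nu> by fact
  have cost: "quadratic_cost \<nu> ?T W k lam k0 k1 W1"
  proof (intro quadratic_cost.intro quadratic_cost_axioms.intro)
    show "W \<in> borel_measurable \<nu>"
      using borel_measurable_lift2[OF cW fst_m snd_m] by simp
    have "(\<lambda>p. K (snd (fst p), snd p)) \<in> borel_measurable (\<nu> \<Otimes>\<^sub>M ?T)"
      by (rule borel_measurable_lift2[OF cK measurable_compose[OF measurable_fst snd_m]])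
         (simp add: measurable_cong_sets[OF refl sets_torus_measure, symmetric])
    then show "k \<in> borel_measurable (\<nu> \<Otimes>\<^sub>M ?T)"
      by (simp add: k_def case_prod_beta')
    show "k0 \<le> k p" "k p \<le> k1" for p
      using k0(3) k1 by (auto simp: k_def split: prod.split)
  qed (use W1 k0 assms(6,8) prob_space_torus_measure in auto)
  have "J_functional V K lam \<nu> = (\<lambda>f. quadratic_cost.cost \<nu> ?T W k lam (weak_gradient f))"
    unfolding J_functional_def quadratic_cost.cost_def[OF cost]
    by (simp add: W_def k_def case_prod_beta')
  then show ?thesis
    using torus_gradient_minimizer[OF cost] by simp
qed

end
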